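(* Let $\phi$ be a formula not provable in $\mathsf{PA}$. Then there exists a family $F$ of true axioms, consisting of exactly one axiom of the form "$\mathrm{C}(\bar x)=\bar n_1\ \lor\ \mathrm{C}(\bar x)=\bar n_2$" for each binary string $x$ (with natural numbers $n_1,n_2$ depending on $x$), such that $\mathsf{PA}\cup F$ does not prove $\phi$.
   Context: $\mathsf{PA}$ is Peano arithmetic; "true" means true in the standard model; $\bar k$ denotes the numeral for $k$, strings identified with natural numbers. $\mathrm{C}$ is plain Kolmogorov complexity, represented in $\mathsf{PA}$ as $\mathrm{C}_D(x)=\min\{|p|:D(p)=x\}$ for a provably optimal interpreter $D$ (for every partial computable $D'$ there is $c$ with $\mathsf{PA}\vdash\forall x\,[\mathrm{C}_D(x)\le\mathrm{C}_{D'}(x)+c]$). *)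

theory Defs
  imports Main "HOL-Library.More_List" "HOL-Number_Theory.Cong"
begin

section \<open>First-order arithmetic\<close>

text \<open>Variables are de Bruijn indices; \<^term>\<open>All\<close> below binds index 0.\<close>

datatype tm = Var nat | Zero | Sc tm | Add tm tm | Mul tm tm

datatype fm = Fls | Eq tm tm (infix "\<doteq>" 60) | Imp fm fm (infixr "\<rightarrow>\<^sub>F" 52) | All fm

definition Neg :: "fm \<Rightarrow> fm" where "Neg \<phi> = (\<phi> \<rightarrow>\<^sub>F Fls)"
definition Disj :: "fm \<Rightarrow> fm \<Rightarrow> fm" (infixr "\<or>\<^sub>F" 54) where "\<phi> \<or>\<^sub>F \<psi> = (Neg \<phi> \<rightarrow>\<^sub>F \<psi>)"
definition Conj :: "fm \<Rightarrow> fm \<Rightarrow> fm" (infixr "\<and>\<^sub>F" 56) where "\<phi> \<and>\<^sub>F \<psi> = Neg (\<phi> \<rightarrow>\<^sub>F Neg \<psi>)"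
definition Exi :: "fm \<Rightarrow> fm" where "Exi \<phi> = Neg (All (Neg \<phi>))"

primrec tsubst :: "(nat \<Rightarrow> tm) \<Rightarrow> tm \<Rightarrow> tm" where
  "tsubst \<sigma> (Var i) = \<sigma> i"
| "tsubst \<sigma> Zero = Zero"
| "tsubst \<sigma> (Sc t) = Sc (tsubst \<sigma> t)"
| "tsubst \<sigma> (Add s t) = Add (tsubst \<sigma> s) (tsubst \<sigma> t)"
| "tsubst \<sigma> (Mul s t) = Mul (tsubst \<sigma> s) (tsubst \<sigma> t)"

definition tlift :: "nat \<Rightarrow> tm \<Rightarrow> tm" where
  "tlift k = tsubst (\<lambda>i. Var (i + k))"

primrec fsubst :: "(nat \<Rightarrow> tm) \<Rightarrow> fm \<Rightarrow> fm" where
  "fsubst \<sigma> Fls = Fls"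
| "fsubst \<sigma> (s \<doteq> t) = (tsubst \<sigma> s \<doteq> tsubst \<sigma> t)"
| "fsubst \<sigma> (\<phi> \<rightarrow>\<^sub>F \<psi>) = (fsubst \<sigma> \<phi> \<rightarrow>\<^sub>F fsubst \<sigma> \<psi>)"
| "fsubst \<sigma> (All \<phi>) = All (fsubst (case_nat (Var 0) (\<lambda>i. tlift 1 (\<sigma> i))) \<phi>)"

definition flift :: "fm \<Rightarrow> fm" where
  "flift = fsubst (\<lambda>i. Var (Suc i))"

definition inst :: "fm \<Rightarrow> tm \<Rightarrow> fm" where
  "inst \<phi> t = fsubst (case_nat t Var) \<phi>"

primrec tbelow :: "nat \<Rightarrow> tm \<Rightarrow> bool" where
  "tbelow k (Var i) \<longleftrightarrow> i < k"
| "tbelow k Zero \<longleftrightarrow> True"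
| "tbelow k (Sc t) \<longleftrightarrow> tbelow k t"
| "tbelow k (Add s t) \<longleftrightarrow> tbelow k s \<and> tbelow k t"
| "tbelow k (Mul s t) \<longleftrightarrow> tbelow k s \<and> tbelow k t"

primrec fbelow :: "nat \<Rightarrow> fm \<Rightarrow> bool" where
  "fbelow k Fls \<longleftrightarrow> True"
| "fbelow k (s \<doteq> t) \<longleftrightarrow> tbelow k s \<and> tbelow k t"
| "fbelow k (\<phi> \<rightarrow>\<^sub>F \<psi>) \<longleftrightarrow> fbelow k \<phi> \<and> fbelow k \<psi>"
| "fbelow k (All \<phi>) \<longleftrightarrow> fbelow (Suc k) \<phi>"

text \<open>The standard model.\<close>

primrec tval :: "(nat \<Rightarrow> nat) \<Rightarrow> tm \<Rightarrow> nat" where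
  "tval e (Var i) = e i"
| "tval e Zero = 0"
| "tval e (Sc t) = Suc (tval e t)"
| "tval e (Add s t) = tval e s + tval e t"
| "tval e (Mul s t) = tval e s * tval e t"

primrec sat :: "(nat \<Rightarrow> nat) \<Rightarrow> fm \<Rightarrow> bool" where
  "sat e Fls \<longleftrightarrow> False"
| "sat e (s \<doteq> t) \<longleftrightarrow> tval e s = tval e t"
| "sat e (\<phi> \<rightarrow>\<^sub>F \<psi>) \<longleftrightarrow> (sat e \<phi> \<longrightarrow> sat e \<psi>)"
| "sat e (All \<phi>) \<longleftrightarrow> (\<forall>x. sat (case_nat x e) \<phi>)"

definition true_in_N :: "fm \<Rightarrow> bool" where
  "true_in_N \<phi> \<longleftrightarrow> (\<forall>e. sat e \<phi>)"

text \<open>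
  Classical natural deduction with equality.  Free variables of the hypotheses act as
  parameters: the generalisation rule shifts them out of the way of the new bound variable.
\<close>

inductive prv :: "fm set \<Rightarrow> fm \<Rightarrow> bool" (infix "\<turnstile>" 50) where
  assm: "\<phi> \<in> \<Gamma> \<Longrightarrow> \<Gamma> \<turnstile> \<phi>"
| contr: "insert (Neg \<phi>) \<Gamma> \<turnstile> Fls \<Longrightarrow> \<Gamma> \<turnstile> \<phi>"
| impI: "insert \<phi> \<Gamma> \<turnstile> \<psi> \<Longrightarrow> \<Gamma> \<turnstile> \<phi> \<rightarrow>\<^sub>F \<psi>"
| impE: "\<Gamma> \<turnstile> \<phi> \<rightarrow>\<^sub>F \<psi> \<Longrightarrow> \<Gamma> \<turnstile> \<phi> \<Longrightarrow> \<Gamma> \<turnstile> \<psi>"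
| allI: "flift ` \<Gamma> \<turnstile> \<phi> \<Longrightarrow> \<Gamma> \<turnstile> All \<phi>"
| allE: "\<Gamma> \<turnstile> All \<phi> \<Longrightarrow> \<Gamma> \<turnstile> inst \<phi> t"
| eq_refl: "\<Gamma> \<turnstile> t \<doteq> t"
| eq_subst: "\<Gamma> \<turnstile> s \<doteq> t \<Longrightarrow> \<Gamma> \<turnstile> inst \<phi> s \<Longrightarrow> \<Gamma> \<turnstile> inst \<phi> t"

definition induction_fm :: "fm \<Rightarrow> fm" where
  "induction_fm \<phi> =
     (inst \<phi> Zero \<rightarrow>\<^sub>F
      All (\<phi> \<rightarrow>\<^sub>F fsubst (case_nat (Sc (Var 0)) (\<lambda>i. Var (Suc i))) \<phi>) \<rightarrow>\<^sub>F
      All \<phi>)"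

text \<open>
  Every axiom is a sentence: an induction axiom is the universal closure of an instance of the
  schema.  Extra vacuous quantifiers are harmless.
\<close>

inductive_set PA :: "fm set" where
  "All (Neg (Sc (Var 0) \<doteq> Zero)) \<in> PA"
| "All (All (Sc (Var 0) \<doteq> Sc (Var 1) \<rightarrow>\<^sub>F Var 0 \<doteq> Var 1)) \<in> PA"
| "All (Add (Var 0) Zero \<doteq> Var 0) \<in> PA"
| "All (All (Add (Var 0) (Sc (Var 1)) \<doteq> Sc (Add (Var 0) (Var 1)))) \<in> PA"
| "All (Mul (Var 0) Zero \<doteq> Zero) \<in> PA"
| "All (All (Mul (Var 0) (Sc (Var 1)) \<doteq> Add (Mul (Var 0) (Var 1)) (Var 0))) \<in> PA"
| "fbelow k (induction_fm \<phi>) \<Longrightarrow> (All ^^ k) (induction_fm \<phi>) \<in> PA"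

definition numeral_tm :: "nat \<Rightarrow> tm" where
  "numeral_tm n = (Sc ^^ n) Zero"


section \<open>Partial recursive functions and their representation\<close>

text \<open>
  A program denotes a partial function of argument lists; missing arguments count as 0, so no
  arity discipline is needed.  \<^term>\<open>computes f xs z\<close> says that \<^term>\<open>f\<close> halts on
  \<^term>\<open>xs\<close> with output \<^term>\<open>z\<close>.  Primitive recursion is on the first argument, and
  minimisation searches for a first argument.
\<close>

datatype recf = ZeroF | SuccF | Proj nat | Comp recf "recf list" | PrimRec recf recf | Mu recf

primrec computes :: "recf \<Rightarrow> nat list \<Rightarrow> nat \<Rightarrow> bool" where
  "computes ZeroF = (\<lambda>xs z. z = 0)"
| "computes SuccF = (\<lambda>xs z. z = Suc (nth_default 0 xs 0))"
| "computes (Proj i) = (\<lambda>xs z. z = nth_default 0 xs i)"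
| "computes (Comp f gs) = (\<lambda>xs z.
     \<exists>ys. list_all2 (\<lambda>G y. G xs y) (map computes gs) ys \<and> computes f ys z)"
| "computes (PrimRec f g) = (\<lambda>xs z.
     \<exists>s. computes f (tl xs) (s 0) \<and>
         (\<forall>i < nth_default 0 xs 0. computes g (i # s i # tl xs) (s (Suc i))) \<and>
         s (nth_default 0 xs 0) = z)"
| "computes (Mu f) = (\<lambda>xs z.
     computes f (z # xs) 0 \<and> (\<forall>i < z. \<exists>u. computes f (i # xs) (Suc u)))"

text \<open>Each formula below is a function of the terms put in for its free variables.\<close>

definition Le :: "tm \<Rightarrow> tm \<Rightarrow> fm" where
  "Le s t = Exi (Add (tlift 1 s) (Var 0) \<doteq> tlift 1 t)"

definition Lt :: "tm \<Rightarrow> tm \<Rightarrow> fm" where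
  "Lt s t = Le (Sc s) t"

definition AllLt :: "tm \<Rightarrow> fm \<Rightarrow> fm" where
  "AllLt t \<phi> = All (Lt (Var 0) (tlift 1 t) \<rightarrow>\<^sub>F \<phi>)"

primrec Conjs :: "fm list \<Rightarrow> fm" where
  "Conjs [] = (Zero \<doteq> Zero)"
| "Conjs (\<phi> # \<phi>s) = (\<phi> \<and>\<^sub>F Conjs \<phi>s)"

text \<open>
  Goedel's beta function: \<^term>\<open>Beta a b i r\<close> says that the \<^term>\<open>i\<close>-th entry of the sequence
  coded by \<^term>\<open>a\<close> and \<^term>\<open>b\<close>, the remainder of \<^term>\<open>a\<close> modulo
  \<open>1 + (i + 1) * b\<close>, is \<^term>\<open>r\<close>.
\<close>

definition Beta :: "tm \<Rightarrow> tm \<Rightarrow> tm \<Rightarrow> tm \<Rightarrow> fm" where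
  "Beta a b i r =
     Exi (tlift 1 a \<doteq> Add (Mul (Var 0) (tlift 1 (Sc (Mul (Sc i) b)))) (tlift 1 r)) \<and>\<^sub>F
     Lt r (Sc (Mul (Sc i) b))"

text \<open>
  The arithmetical formula expressing \<^term>\<open>computes f ts z\<close>, clause by clause.  For composition,
  the variables \<^term>\<open>Var i\<close> with \<^term>\<open>i < length gs\<close> are the intermediate values.  For primitive
  recursion, the two outermost quantifiers introduce the code of the sequence of values; the bounded
  quantifier introduces the position, and the two quantifiers inside it the entries at that position
  and at the next.
\<close>

primrec graph :: "recf \<Rightarrow> tm list \<Rightarrow> tm \<Rightarrow> fm" where
  "graph ZeroF = (\<lambda>ts z. z \<doteq> Zero)"
| "graph SuccF = (\<lambda>ts z. z \<doteq> Sc (nth_default Zero ts 0))"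
| "graph (Proj i) = (\<lambda>ts z. z \<doteq> nth_default Zero ts i)"
| "graph (Comp f gs) = (\<lambda>ts z. let k = length gs in
     (Exi ^^ k)
       (Conjs (map2 (\<lambda>G i. G (map (tlift k) ts) (Var i)) (map graph gs) [0..<k]) \<and>\<^sub>F
        graph f (map Var [0..<k]) (tlift k z)))"
| "graph (PrimRec f g) = (\<lambda>ts z. let n = nth_default Zero ts 0; ps = tl ts in
     Exi (Exi (
       Exi (Beta (Var 2) (Var 1) Zero (Var 0) \<and>\<^sub>F graph f (map (tlift 3) ps) (Var 0)) \<and>\<^sub>F
       AllLt (tlift 2 n)
         (Exi (Exi (Beta (Var 4) (Var 3) (Var 2) (Var 1) \<and>\<^sub>F
                  Beta (Var 4) (Var 3) (Sc (Var 2)) (Var 0) \<and>\<^sub>F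
                  graph g (Var 2 # Var 1 # map (tlift 5) ps) (Var 0)))) \<and>\<^sub>F
       Beta (Var 1) (Var 0) (tlift 2 n) (tlift 2 z))))"
| "graph (Mu f) = (\<lambda>ts z.
     graph f (z # ts) Zero \<and>\<^sub>F
     AllLt z (Exi (graph f (Var 1 # map (tlift 2) ts) (Sc (Var 0)))))"


section \<open>Kolmogorov complexity\<close>

text \<open>
  Binary strings are numbered in length-lexicographic order: the number of \<open>xs\<close> is one less than
  the number with binary expansion \<open>1xs\<close>.  So \<open>xs\<close> has length \<open>n\<close> iff its number \<open>c\<close> satisfies
  \<open>2 ^ n \<le> c + 1 < 2 * 2 ^ n\<close>.
\<close>

definition string_code :: "bool list \<Rightarrow> nat" where
  "string_code xs = foldl (\<lambda>c b. 2 * c + (if b then 2 else 1)) 0 xs"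

definition Pow2 :: "tm \<Rightarrow> tm \<Rightarrow> fm" where
  "Pow2 n r =
     Exi (Exi (Beta (Var 1) (Var 0) Zero (Sc Zero) \<and>\<^sub>F
       AllLt (tlift 2 n)
         (Exi (Beta (Var 3) (Var 2) (Var 1) (Var 0) \<and>\<^sub>F
              Beta (Var 3) (Var 2) (Sc (Var 1)) (Add (Var 0) (Var 0)))) \<and>\<^sub>F
       Beta (Var 1) (Var 0) (tlift 2 n) (tlift 2 r)))"

definition Len :: "tm \<Rightarrow> tm \<Rightarrow> fm" where
  "Len p n =
     Exi (Pow2 (tlift 1 n) (Var 0) \<and>\<^sub>F Le (Var 0) (Sc (tlift 1 p)) \<and>\<^sub>F
         Lt (Sc (tlift 1 p)) (Add (Var 0) (Var 0)))"

text \<open>\<^term>\<open>HasProg D x n\<close>: some \<open>p\<close> of length \<open>n\<close> satisfies \<open>D(p) = x\<close>.\<close>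

definition HasProg :: "recf \<Rightarrow> tm \<Rightarrow> tm \<Rightarrow> fm" where
  "HasProg D x n = Exi (Len (Var 0) (tlift 1 n) \<and>\<^sub>F graph D [Var 0] (tlift 1 x))"

text \<open>\<^term>\<open>CEq D x n\<close> is the formula \<open>C\<^sub>D(x) = n\<close>, where \<open>C\<^sub>D(x) = min {|p|. D(p) = x}\<close>.\<close>

definition CEq :: "recf \<Rightarrow> tm \<Rightarrow> tm \<Rightarrow> fm" where
  "CEq D x n = (HasProg D x n \<and>\<^sub>F AllLt n (Neg (HasProg D (tlift 1 x) (Var 0))))"

text \<open>
  \<open>\<forall>x. C\<^sub>D(x) \<le> C\<^sub>E(x) + c\<close>, with the minimum of the empty set being infinite: if \<open>C\<^sub>E(x) = n\<close>
  then \<open>C\<^sub>D(x) = m\<close> for some \<open>m \<le> n + c\<close>.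
\<close>

definition CLe :: "recf \<Rightarrow> recf \<Rightarrow> nat \<Rightarrow> fm" where
  "CLe D E c =
     All (All (CEq E (Var 1) (Var 0) \<rightarrow>\<^sub>F
       Exi (Le (Var 0) (Add (Var 1) (numeral_tm c)) \<and>\<^sub>F CEq D (Var 2) (Var 0))))"

text \<open>
  Interpreters are programs used with a single argument; inside PA, a partial computable function
  is given by the formula \<^term>\<open>graph E\<close> of a program \<open>E\<close> for it.
\<close>

definition provably_optimal :: "recf \<Rightarrow> bool" where
  "provably_optimal D \<longleftrightarrow> (\<forall>E. \<exists>c. PA \<turnstile> CLe D E c)"

definition two_values_axiom :: "recf \<Rightarrow> bool list \<Rightarrow> nat \<Rightarrow> nat \<Rightarrow> fm" where
  "two_values_axiom D x n\<^sub>1 n\<^sub>2 =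
     (CEq D (numeral_tm (string_code x)) (numeral_tm n\<^sub>1) \<or>\<^sub>F
      CEq D (numeral_tm (string_code x)) (numeral_tm n\<^sub>2))"

section \<open>Adequacy of the arithmetization\<close>

lemma sat_connectives [simp]:
  "sat e (Neg \<phi>) \<longleftrightarrow> \<not> sat e \<phi>"
  "sat e (\<phi> \<or>\<^sub>F \<psi>) \<longleftrightarrow> sat e \<phi> \<or> sat e \<psi>"
  "sat e (\<phi> \<and>\<^sub>F \<psi>) \<longleftrightarrow> sat e \<phi> \<and> sat e \<psi>"
  "sat e (Exi \<phi>) \<longleftrightarrow> (\<exists>x. sat (case_nat x e) \<phi>)"
  by (auto simp: Neg_def Disj_def Conj_def Exi_def)

lemma tval_tsubst: "tval e (tsubst \<sigma> t) = tval (\<lambda>i. tval e (\<sigma> i)) t"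
  by (induction t) auto

lemma tval_tlift [simp]: "tval e (tlift k t) = tval (\<lambda>i. e (i + k)) t"
  by (simp add: tlift_def tval_tsubst)

lemma tval_numeral [simp]: "tval e (numeral_tm n) = n"
  unfolding numeral_tm_def by (induction n) auto

lemma case_nat_shift [simp]:
  "(\<lambda>i. case_nat x e (i + numeral k)) = (\<lambda>i. e (i + pred_numeral k))"
  "(\<lambda>i. case_nat x e (Suc i)) = e"
  by (simp_all add: fun_eq_iff numeral_eq_Suc)

lemma case_nat_numeral_arg [simp]: "case_nat x e (numeral k) = e (pred_numeral k)"
  by (simp add: numeral_eq_Suc)

lemma sat_Le [simp]: "sat e (Le s t) \<longleftrightarrow> tval e s \<le> tval e t"
  by (auto simp: Le_def le_iff_add eq_commute)

lemma sat_Lt [simp]: "sat e (Lt s t) \<longleftrightarrow> tval e s < tval e t"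
  by (simp add: Lt_def Suc_le_eq)

lemma sat_AllLt [simp]: "sat e (AllLt t \<phi>) \<longleftrightarrow> (\<forall>x < tval e t. sat (case_nat x e) \<phi>)"
  by (simp add: AllLt_def)

lemma sat_Conjs [simp]: "sat e (Conjs \<phi>s) \<longleftrightarrow> (\<forall>\<phi> \<in> set \<phi>s. sat e \<phi>)"
  by (induction \<phi>s) auto

lemma sat_Beta [simp]:
  "sat e (Beta a b i r) \<longleftrightarrow> tval e a mod Suc (Suc (tval e i) * tval e b) = tval e r"
proof -
  have "(\<exists>q. a' = q * m + r') \<and> r' < m \<longleftrightarrow> a' mod m = r'" if "m > 0" for a' m r' :: nat
    using that by (auto intro: exI[of _ "a' div m"])
  from this[of "Suc (Suc (tval e i) * tval e b)" "tval e a" "tval e r"] show ?thesis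
    by (simp add: Beta_def)
qed

lemma beta_exists: "\<exists>a b. \<forall>i \<le> n. a mod Suc (Suc i * b) = (s i :: nat)"
proof -
  define M where "M = Suc (n + (\<Sum>i\<le>n. s i))"
  define b where "b = (fact M :: nat)"
  define m where "m = (\<lambda>i. Suc (Suc i * b))"
  have cop: "coprime (m i) (m j)" if "i < j" "j \<le> n" for i j
  proof (rule ccontr)
    assume "\<not> coprime (m i) (m j)"
    then obtain p where p: "prime p" "p dvd m i" "p dvd m j"
      by (metis coprime_iff_gcd_eq_1 gcd_dvd1 gcd_dvd2 dvd_trans prime_factor_nat)
    have nb: "\<not> p dvd b"
    proof
      assume "p dvd b"
      then have "p dvd Suc i * b" by simp
      with p(2) have "p dvd 1"
        unfolding m_def by (metis dvd_add_right_iff Suc_eq_plus1)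
      with p(1) show False by auto
    qed
    have "m j - m i = (j - i) * b"
      by (simp add: m_def algebra_simps)
    then have "p dvd (j - i) * b"
      using p by (metis dvd_diff_nat)
    with nb p(1) have "p dvd j - i"
      by (simp add: prime_dvd_mult_iff)
    then have "p \<le> M"
      using that by (auto dest!: dvd_imp_le simp: M_def)
    then have "p dvd b"
      unfolding b_def using prime_gt_0_nat[OF p(1)] by (intro dvd_fact) auto
    with nb show False ..
  qed
  have "\<forall>i\<in>{..n}. \<forall>j\<in>{..n}. i \<noteq> j \<longrightarrow> coprime (m i) (m j)"
    using cop by (metis atMost_iff coprime_commute linorder_neqE_nat)
  then obtain a where a: "\<forall>i\<in>{..n}. [a = s i] (mod m i)"
    using chinese_remainder_nat[of "{..n}" m s] by auto
  have "s i < m i" if "i \<le> n" for i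
  proof -
    have "s i \<le> (\<Sum>i\<le>n. s i)"
      using that by (intro member_le_sum) auto
    also have "\<dots> \<le> M" by (simp add: M_def)
    also have "\<dots> \<le> b" unfolding b_def by (rule fact_ge_self)
    finally show ?thesis by (simp add: m_def)
  qed
  with a have "\<forall>i\<le>n. a mod m i = s i"
    by (simp add: cong_def)
  then show ?thesis by (auto simp: m_def)
qed

lemma sat_Exs:
  "sat e ((Exi ^^ k) \<phi>) \<longleftrightarrow>
   (\<exists>ys. length ys = k \<and> sat (\<lambda>i. if i < k then ys ! i else e (i - k)) \<phi>)"
proof (induction k arbitrary: e)
  case (Suc k)
  have eq: "(\<lambda>i. if i < k then ys ! i else case_nat x e (i - k)) =
        (\<lambda>i. if i < Suc k then (ys @ [x]) ! i else e (i - Suc k))"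
    if "length ys = k" for ys x
  proof
    fix i
    consider "i < k" | "i = k" | j where "i = Suc (k + j)"
      by (metis less_imp_Suc_add linorder_neqE_nat)
    then show "(if i < k then ys ! i else case_nat x e (i - k)) =
        (if i < Suc k then (ys @ [x]) ! i else e (i - Suc k))"
      using that by cases (auto simp: nth_append)
  qed
  show ?case
  proof
    assume "sat e ((Exi ^^ Suc k) \<phi>)"
    then obtain x ys where "length ys = k"
      "sat (\<lambda>i. if i < k then ys ! i else case_nat x e (i - k)) \<phi>"
      by (auto simp: Suc)
    then show "\<exists>ys. length ys = Suc k \<and>
        sat (\<lambda>i. if i < Suc k then ys ! i else e (i - Suc k)) \<phi>"
      using eq by (intro exI[of _ "ys @ [x]"]) (simp del: nth_append)
  next
    assume "\<exists>ys. length ys = Suc k \<and>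
        sat (\<lambda>i. if i < Suc k then ys ! i else e (i - Suc k)) \<phi>"
    then obtain zs where zs: "length zs = Suc k"
      "sat (\<lambda>i. if i < Suc k then zs ! i else e (i - Suc k)) \<phi>" by blast
    then obtain ys x where ys: "zs = ys @ [x]" "length ys = k"
      by (metis length_Suc_conv_rev)
    have "sat (\<lambda>i. if i < k then ys ! i else case_nat x e (i - k)) \<phi>"
      using zs(2) unfolding ys(1) eq[OF ys(2)] .
    with \<open>length ys = k\<close> show "sat e ((Exi ^^ Suc k) \<phi>)"
      by (auto simp: Suc)
  qed
qed simp

lemma tval_nth_default [simp]:
  "tval e (nth_default Zero ts i) = nth_default 0 (map (tval e) ts) i"
  by (simp add: nth_default_def)

lemma sat_graph:
  "sat e (graph f ts z) \<longleftrightarrow> computes f (map (tval e) ts) (tval e z)"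
proof (induction f arbitrary: e ts z)
  case (Comp f gs)
  define k where "k = length gs"
  define E where "E = (\<lambda>ys i. if i < k then ys ! i else e (i - k))"
  have [simp]: "tval (\<lambda>i. E ys (i + k)) = tval e" for ys
    by (simp add: E_def)
  have 1: "map (E ys) [0..<k] = ys" if "length ys = k" for ys
    using that by (auto simp: list_eq_iff_nth_eq E_def)
  have 2: "(\<forall>\<phi>\<in>set (map2 (\<lambda>G i. G (map (tlift k) ts) (Var i)) (map graph gs) [0..<k]).
              sat (E ys) \<phi>) \<longleftrightarrow>
           list_all2 (\<lambda>G y. G (map (tval e) ts) y) (map computes gs) ys" (is "?L \<longleftrightarrow> ?R")
    if ys: "length ys = k" for ys
  proof -
    have "?L \<longleftrightarrow> (\<forall>i<k. sat (E ys) (graph (gs ! i) (map (tlift k) ts) (Var i)))"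
      by (force simp: set_zip k_def)
    also have "\<dots> \<longleftrightarrow> (\<forall>i<k. computes (gs ! i) (map (tval e) ts) (ys ! i))"
      using Comp.IH(2)[OF nth_mem] by (auto simp: comp_def k_def E_def)
    also have "\<dots> \<longleftrightarrow> ?R"
      using ys by (auto simp: list_all2_conv_all_nth k_def)
    finally show ?thesis .
  qed
  have 3: "sat (E ys) (graph f (map Var [0..<k]) (tlift k z)) \<longleftrightarrow> computes f ys (tval e z)"
    if "length ys = k" for ys
    using 1[OF that] by (simp add: Comp.IH(1) comp_def)
  have "sat e (graph (Comp f gs) ts z) \<longleftrightarrow> (\<exists>ys. length ys = k \<and>
          sat (E ys) (Conjs (map2 (\<lambda>G i. G (map (tlift k) ts) (Var i)) (map graph gs) [0..<k]) \<and>\<^sub>F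
            graph f (map Var [0..<k]) (tlift k z)))"
    by (simp only: graph.simps Let_def sat_Exs k_def E_def)
  also have "\<dots> \<longleftrightarrow> (\<exists>ys. length ys = k \<and>
          list_all2 (\<lambda>G y. G (map (tval e) ts) y) (map computes gs) ys \<and>
          computes f ys (tval e z))"
    by (simp only: sat_connectives sat_Conjs 2 3 cong: conj_cong)
  finally have "sat e (graph (Comp f gs) ts z) \<longleftrightarrow>
        (\<exists>ys. length ys = k \<and>
          list_all2 (\<lambda>G y. G (map (tval e) ts) y) (map computes gs) ys \<and>
          computes f ys (tval e z))" .
  then show ?case
    unfolding k_def computes.simps by (metis (no_types, lifting) length_map list_all2_lengthD)
next
  case (PrimRec f g)
  let ?n = "nth_default 0 (map (tval e) ts) 0" and ?xs = "map (tval e) (tl ts)"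
  have "sat e (graph (PrimRec f g) ts z) \<longleftrightarrow>
    (\<exists>a b. computes f ?xs (a mod Suc (Suc 0 * b)) \<and>
       (\<forall>i < ?n. computes g (i # a mod Suc (Suc i * b) # ?xs) (a mod Suc (Suc (Suc i) * b))) \<and>
       a mod Suc (Suc ?n * b) = tval e z)"
    by (simp add: Let_def PrimRec.IH comp_def)
  also have "\<dots> \<longleftrightarrow> (\<exists>s. computes f ?xs (s 0) \<and>
       (\<forall>i < ?n. computes g (i # s i # ?xs) (s (Suc i))) \<and> s ?n = tval e z)" (is "?L \<longleftrightarrow> ?R")
  proof
    assume ?R
    then obtain s where s: "computes f ?xs (s 0)"
      "\<forall>i < ?n. computes g (i # s i # ?xs) (s (Suc i))" "s ?n = tval e z" by blast
    obtain a b where "\<forall>i \<le> ?n. a mod Suc (Suc i * b) = s i"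
      using beta_exists by blast
    with s show ?L
      by (intro exI[of _ a] exI[of _ b]) (auto simp del: mult_Suc)
  next
    assume ?L
    then obtain a b where "computes f ?xs (a mod Suc (Suc 0 * b))"
       "\<forall>i < ?n. computes g (i # a mod Suc (Suc i * b) # ?xs) (a mod Suc (Suc (Suc i) * b))"
       "a mod Suc (Suc ?n * b) = tval e z" by blast
    then show ?R
      by (intro exI[of _ "\<lambda>i. a mod Suc (Suc i * b)"]) blast
  qed
  finally show ?case by (simp add: map_tl)
qed (simp_all add: comp_def)

lemma sat_Pow2 [simp]: "sat e (Pow2 n r) \<longleftrightarrow> 2 ^ tval e n = tval e r"
proof -
  have "sat e (Pow2 n r) \<longleftrightarrow>
    (\<exists>a b. a mod Suc (Suc 0 * b) = 1 \<and>
       (\<forall>i < tval e n. a mod Suc (Suc (Suc i) * b) = 2 * (a mod Suc (Suc i * b))) \<and>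
       a mod Suc (Suc (tval e n) * b) = tval e r)"
    by (simp add: Pow2_def mult_2)
  also have "\<dots> \<longleftrightarrow> 2 ^ tval e n = tval e r" (is "?L \<longleftrightarrow> ?R")
  proof
    assume ?L
    then obtain a b where ab: "a mod Suc (Suc 0 * b) = 1"
       "\<forall>i < tval e n. a mod Suc (Suc (Suc i) * b) = 2 * (a mod Suc (Suc i * b))"
       "a mod Suc (Suc (tval e n) * b) = tval e r" by blast
    have "i \<le> tval e n \<Longrightarrow> a mod Suc (Suc i * b) = 2 ^ i" for i
      by (induction i) (use ab(1,2) in \<open>auto simp del: mult_Suc\<close>)
    with ab(3) show ?R by simp
  next
    assume ?R
    obtain a b where "\<forall>i \<le> tval e n. a mod Suc (Suc i * b) = 2 ^ i"
      using beta_exists by blast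
    with \<open>?R\<close> show ?L
      by (intro exI[of _ a] exI[of _ b]) (auto simp del: mult_Suc)
  qed
  finally show ?thesis .
qed

lemma string_code_simps:
  "string_code [] = 0"
  "string_code (xs @ [b]) = 2 * string_code xs + (if b then 2 else 1)"
  by (simp_all add: string_code_def)

lemma string_code_bounds:
  "2 ^ length xs \<le> Suc (string_code xs)" "Suc (string_code xs) < 2 * 2 ^ length xs"
  by (induction xs rule: rev_induct) (auto simp: string_code_simps)

lemma bij_string_code: "bij string_code"
proof (rule bijI)
  show "inj string_code"
  proof (rule injI)
    show "string_code xs = string_code ys \<Longrightarrow> xs = ys" for xs ys
    proof (induction xs arbitrary: ys rule: rev_induct)
      case Nil
      then show ?case
        by (cases ys rule: rev_cases) (auto simp: string_code_simps split: if_splits)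
    next
      case (snoc b xs)
      show ?case
      proof (cases ys rule: rev_cases)
        case Nil
        with snoc.prems show ?thesis by (auto simp: string_code_simps split: if_splits)
      next
        case (snoc ys' b')
        with snoc.prems have "b = b'" "string_code xs = string_code ys'"
          by (simp_all add: string_code_simps split: if_splits) presburger+
        with snoc.IH snoc show ?thesis by simp
      qed
    qed
  qed
  have "\<exists>xs. string_code xs = c" for c
  proof (induction c rule: less_induct)
    case (less c)
    have "c = 0 \<or> (\<exists>d. c = 2 * d + 1) \<or> (\<exists>d. c = 2 * d + 2)"
      by presburger
    then consider "c = 0" | d where "c = 2 * d + 1" | d where "c = 2 * d + 2"
      by blast
    then show ?case
    proof cases
      case 1 then show ?thesis by (metis string_code_simps(1))
    next
      case 2
      with less[of d] obtain xs where "string_code xs = d" by auto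
      with 2 show ?thesis by (intro exI[of _ "xs @ [False]"]) (simp add: string_code_simps)
    next
      case 3
      with less[of d] obtain xs where "string_code xs = d" by auto
      with 3 show ?thesis by (intro exI[of _ "xs @ [True]"]) (simp add: string_code_simps)
    qed
  qed
  then show "surj string_code" by (metis surjI)
qed

lemma sat_Len:
  assumes "tval e p = string_code xs"
  shows "sat e (Len p n) \<longleftrightarrow> length xs = tval e n"
proof -
  have *: "m = k" if "2 ^ m \<le> c" "c < 2 * 2 ^ m" "2 ^ k \<le> c" "c < 2 * 2 ^ k" for m k c :: nat
  proof -
    have "(2::nat) ^ m < 2 ^ Suc k" "(2::nat) ^ k < 2 ^ Suc m"
      using that by (simp_all del: power_Suc add: power_Suc le_less_trans)
    then have "m < Suc k" "k < Suc m"
      using power_less_imp_less_exp[of "2::nat"] by (metis one_less_numeral_iff semiring_norm(76))+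
    then show ?thesis by simp
  qed
  have "sat e (Len p n) \<longleftrightarrow> 2 ^ tval e n \<le> Suc (string_code xs) \<and>
          Suc (string_code xs) < 2 * 2 ^ tval e n"
    using assms by (simp add: Len_def mult_2)
  then show ?thesis
    using *[of "length xs" "Suc (string_code xs)" "tval e n"] string_code_bounds[of xs] by metis
qed

lemma sat_HasProg:
  "sat e (HasProg D x n) \<longleftrightarrow>
   (\<exists>p. length p = tval e n \<and> computes D [string_code p] (tval e x))"
proof -
  have "sat e (HasProg D x n) \<longleftrightarrow>
      (\<exists>c. sat (case_nat c e) (Len (Var 0) (tlift 1 n)) \<and> computes D [c] (tval e x))"
    by (simp add: HasProg_def sat_graph)
  also have "\<dots> \<longleftrightarrow> (\<exists>p. sat (case_nat (string_code p) e) (Len (Var 0) (tlift 1 n)) \<and>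
      computes D [string_code p] (tval e x))"
    using bij_string_code by (metis bij_pointE)
  also have "\<dots> \<longleftrightarrow> (\<exists>p. length p = tval e n \<and> computes D [string_code p] (tval e x))"
    by (intro ex_cong1 conj_cong refl) (subst sat_Len, auto)
  finally show ?thesis .
qed

lemma sat_CEq:
  "sat e (CEq D x n) \<longleftrightarrow>
   (\<exists>p. length p = tval e n \<and> computes D [string_code p] (tval e x)) \<and>
   (\<forall>p. computes D [string_code p] (tval e x) \<longrightarrow> tval e n \<le> length p)"
  by (auto simp: CEq_def sat_HasProg not_less[symmetric])

end

theory Submission
  imports Defs
begin

text \<open>
  Extend \<open>PA \<union> {\<not>\<phi>}\<close> to a maximal consistent set \<open>T\<close>.  The identity is an interpreter, so
  \<open>PA\<close> proves \<open>C\<^sub>D(x) \<le> |x| + c\<close> for every fixed \<open>x\<close>; hence \<open>T\<close>, being maximal, decides the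
  value of \<open>C\<^sub>D(x)\<close> as a standard number.  Take it as \<open>n\<^sub>2\<close> and the true value as
  \<open>n\<^sub>1\<close>: the resulting axioms are true, and they all belong to \<open>T\<close>, which does not prove \<open>\<phi>\<close>.
\<close>

section \<open>Substitution\<close>

text \<open>The substitution that \<open>fsubst\<close> applies under a quantifier, named so that it
  has simp rules and can be iterated over blocks of quantifiers.\<close>

definition up :: "(nat \<Rightarrow> tm) \<Rightarrow> nat \<Rightarrow> tm" where
  "up \<sigma> = case_nat (Var 0) (\<lambda>i. tlift 1 (\<sigma> i))"

lemma up_simps [simp]:
  "up \<sigma> 0 = Var 0"
  "up \<sigma> (Suc i) = tlift 1 (\<sigma> i)"
  "up \<sigma> 1 = tlift 1 (\<sigma> 0)"
  "up \<sigma> (numeral k) = tlift 1 (\<sigma> (pred_numeral k))"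
  by (simp_all add: up_def numeral_eq_Suc)

lemma tsubst_tsubst: "tsubst \<sigma> (tsubst \<tau> t) = tsubst (\<lambda>i. tsubst \<sigma> (\<tau> i)) t"
  by (induction t) auto

lemma tsubst_Var [simp]: "tsubst Var t = t"
  by (induction t) auto

lemma tlift_simps [simp]:
  "tlift k (Var i) = Var (i + k)"
  "tlift k Zero = Zero"
  "tlift k (Sc t) = Sc (tlift k t)"
  "tlift k (Add s t) = Add (tlift k s) (tlift k t)"
  "tlift k (Mul s t) = Mul (tlift k s) (tlift k t)"
  by (simp_all add: tlift_def)

lemma tlift_tlift [simp]: "tlift j (tlift k t) = tlift (j + k) t"
  by (simp add: tlift_def tsubst_tsubst add_ac)

lemma tlift_0 [simp]: "tlift 0 t = t"
  by (simp add: tlift_def)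

text \<open>The binder absorbs one lift and leaves the others inside, so the rule can be used once
  per nested quantifier.\<close>

lemma tsubst_up_tlift_Suc: "tsubst (up \<sigma>) (tlift (Suc k) t) = tlift 1 (tsubst \<sigma> (tlift k t))"
  by (simp add: tlift_def tsubst_tsubst)

lemma tsubst_up_tlift [simp]:
  "tsubst (up \<sigma>) (tlift 1 t) = tlift 1 (tsubst \<sigma> t)"
  "tsubst (up \<sigma>) (tlift (Suc 0) t) = tlift 1 (tsubst \<sigma> t)"
  "tsubst (up \<sigma>) (tlift (numeral k) t) = tlift 1 (tsubst \<sigma> (tlift (pred_numeral k) t))"
  using tsubst_up_tlift_Suc[of \<sigma> 0] tsubst_up_tlift_Suc[of \<sigma> "pred_numeral k"]
  by (simp_all add: numeral_eq_Suc)

lemma tsubst_case_nat_tlift [simp]: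
  "tsubst (case_nat t \<sigma>) (tlift 1 s) = tsubst \<sigma> s"
  "tsubst (case_nat t \<sigma>) (tlift (Suc 0) s) = tsubst \<sigma> s"
  by (simp_all add: tlift_def tsubst_tsubst)

lemma tsubst_numeral_tm [simp]: "tsubst \<sigma> (numeral_tm n) = numeral_tm n"
  unfolding numeral_tm_def by (induction n) auto

lemma tlift_numeral_tm [simp]: "tlift k (numeral_tm n) = numeral_tm n"
  by (simp add: tlift_def)

lemma numeral_tm_simps [simp]: "numeral_tm 0 = Zero" "numeral_tm (Suc n) = Sc (numeral_tm n)"
  by (simp_all add: numeral_tm_def)

lemma fsubst_All: "fsubst \<sigma> (All \<phi>) = All (fsubst (up \<sigma>) \<phi>)"
  by (simp add: up_def)

declare fsubst.simps(4) [simp del]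
declare fsubst_All [simp]

lemma fsubst_connectives [simp]:
  "fsubst \<sigma> (Neg \<phi>) = Neg (fsubst \<sigma> \<phi>)"
  "fsubst \<sigma> (\<phi> \<and>\<^sub>F \<psi>) = (fsubst \<sigma> \<phi> \<and>\<^sub>F fsubst \<sigma> \<psi>)"
  "fsubst \<sigma> (Exi \<phi>) = Exi (fsubst (up \<sigma>) \<phi>)"
  by (simp_all add: Neg_def Conj_def Exi_def)

lemma up_tsubst: "(\<lambda>i. tsubst (up \<sigma>) (up \<tau> i)) = up (\<lambda>i. tsubst \<sigma> (\<tau> i))"
proof
  show "tsubst (up \<sigma>) (up \<tau> i) = up (\<lambda>i. tsubst \<sigma> (\<tau> i)) i" for i
    by (cases i) auto
qed

lemma fsubst_fsubst: "fsubst \<sigma> (fsubst \<tau> \<phi>) = fsubst (\<lambda>i. tsubst \<sigma> (\<tau> i)) \<phi>"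
  by (induction \<phi> arbitrary: \<sigma> \<tau>) (auto simp: tsubst_tsubst up_tsubst)

lemma up_Var [simp]: "up Var = Var"
proof
  show "up Var i = Var i" for i by (cases i) auto
qed

lemma fsubst_Var [simp]: "fsubst Var \<phi> = \<phi>"
  by (induction \<phi>) auto

lemma fsubst_cong: "(\<And>i. \<sigma> i = \<tau> i) \<Longrightarrow> fsubst \<sigma> \<phi> = fsubst \<tau> \<phi>"
  by (rule arg_cong[of _ _ "\<lambda>\<sigma>. fsubst \<sigma> \<phi>"]) auto

lemma fsubst_inst: "fsubst \<sigma> (inst \<phi> t) = inst (fsubst (up \<sigma>) \<phi>) (tsubst \<sigma> t)"
  unfolding inst_def fsubst_fsubst by (rule fsubst_cong) (auto split: nat.split)

lemma fsubst_flift: "fsubst (up \<sigma>) (flift \<phi>) = flift (fsubst \<sigma> \<phi>)"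
  unfolding flift_def fsubst_fsubst by (rule fsubst_cong) (auto simp: tlift_def)

text \<open>The shift spares the bound variable, and putting \<open>Var 0\<close> in its place
  undoes the shift. This recovers a quantified body over a fresh parameter.\<close>

lemma inst_up_Suc_Var0: "inst (fsubst (up (\<lambda>i. Var (Suc i))) \<phi>) (Var 0) = \<phi>"
proof -
  have "inst (fsubst (up (\<lambda>i. Var (Suc i))) \<phi>) (Var 0) = fsubst Var \<phi>"
    unfolding inst_def fsubst_fsubst by (rule fsubst_cong) (auto simp: up_def split: nat.split)
  then show ?thesis by simp
qed

text \<open>Passing under a quantifier raises the bound, so \<open>k\<close> is arbitrary; with
  \<open>k = 0\<close>, sentences are fixed by every substitution.\<close>

lemma fsubst_closed_below:
  "fbelow k \<phi> \<Longrightarrow> (\<And>i. i < k \<Longrightarrow> \<sigma> i = Var i) \<Longrightarrow> fsubst \<sigma> \<phi> = \<phi>"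
proof (induction \<phi> arbitrary: k \<sigma>)
  case (Eq s t)
  have "tbelow k t \<Longrightarrow> tsubst \<sigma> t = t" for t
    using Eq.prems(2) by (induction t) auto
  with Eq.prems show ?case by simp
next
  case (All \<phi>)
  have "up \<sigma> i = Var i" if "i < Suc k" for i
    using that All.prems(2) by (cases i) auto
  with All show ?case by (auto simp del: up_simps)
qed auto

lemma fsubst_Exi_funpow: "fsubst \<sigma> ((Exi ^^ k) \<phi>) = (Exi ^^ k) (fsubst ((up ^^ k) \<sigma>) \<phi>)"
  by (induction k arbitrary: \<sigma>) (auto simp: funpow_swap1[of up])

lemma up_funpow_less: "i < k \<Longrightarrow> (up ^^ k) \<sigma> i = Var i"
proof (induction k arbitrary: i)
  case (Suc k)
  then show ?case by (cases i) auto
qed simp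

lemma tsubst_up_funpow: "tsubst ((up ^^ k) \<sigma>) (tlift k t) = tlift k (tsubst \<sigma> t)"
  by (induction k) (simp_all add: tsubst_up_tlift_Suc)

section \<open>Substitution into the arithmetised formulas\<close>

lemma fsubst_Le [simp]: "fsubst \<sigma> (Le s t) = Le (tsubst \<sigma> s) (tsubst \<sigma> t)"
  by (simp add: Le_def)

lemma fsubst_Lt [simp]: "fsubst \<sigma> (Lt s t) = Lt (tsubst \<sigma> s) (tsubst \<sigma> t)"
  by (simp add: Lt_def)

lemma fsubst_AllLt [simp]: "fsubst \<sigma> (AllLt t \<phi>) = AllLt (tsubst \<sigma> t) (fsubst (up \<sigma>) \<phi>)"
  by (simp add: AllLt_def)

lemma fsubst_Beta [simp]:
  "fsubst \<sigma> (Beta a b i r) = Beta (tsubst \<sigma> a) (tsubst \<sigma> b) (tsubst \<sigma> i) (tsubst \<sigma> r)"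
  by (simp add: Beta_def)

lemma fsubst_Conjs [simp]: "fsubst \<sigma> (Conjs \<phi>s) = Conjs (map (fsubst \<sigma>) \<phi>s)"
  by (induction \<phi>s) auto

lemma tsubst_nth_default [simp]:
  "tsubst \<sigma> (nth_default Zero ts i) = nth_default Zero (map (tsubst \<sigma>) ts) i"
  by (simp add: nth_default_def)

text \<open>\<open>graph\<close> lifts its arguments at every binder, so a substitution reaches only
  them. Composition is the delicate case, since its number of binders varies.\<close>

lemma fsubst_graph [simp]:
  "fsubst \<sigma> (graph f ts z) = graph f (map (tsubst \<sigma>) ts) (tsubst \<sigma> z)"
proof (induction f arbitrary: \<sigma> ts z)
  case (Comp f gs)
  define k where "k = length gs"
  \<comment> \<open>The first \<open>k\<close> variables are the intermediate values and stay fixed;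
    only the lifted arguments change.\<close>
  have "map (fsubst ((up ^^ k) \<sigma>))
          (map2 (\<lambda>G i. G (map (tlift k) ts) (Var i)) (map graph gs) [0..<k]) =
        map2 (\<lambda>G i. G (map (tlift k) (map (tsubst \<sigma>) ts)) (Var i)) (map graph gs) [0..<k]"
  proof (rule nth_equalityI, goal_cases)
    case (2 i)
    then have "i < k" "i < length gs" by (simp_all add: k_def)
    then show ?case
      by (simp add: k_def[symmetric] Comp.IH(2) up_funpow_less tsubst_up_funpow comp_def)
  qed simp
  moreover have "map (tsubst ((up ^^ k) \<sigma>)) (map Var [0..<k]) = map Var [0..<k]"
    by (simp add: up_funpow_less)
  ultimately show ?case
    by (simp only: graph.simps Let_def k_def[symmetric] fsubst_Exi_funpow fsubst_connectives
      fsubst_Conjs Comp.IH(1) tsubst_up_funpow)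
next
  case (PrimRec f g)
  then show ?case by (simp add: Let_def comp_def map_tl numeral_eq_Suc tsubst_up_tlift_Suc)
qed (simp_all add: comp_def numeral_eq_Suc tsubst_up_tlift_Suc)

lemma fsubst_Pow2 [simp]: "fsubst \<sigma> (Pow2 n r) = Pow2 (tsubst \<sigma> n) (tsubst \<sigma> r)"
  by (simp add: Pow2_def numeral_eq_Suc tsubst_up_tlift_Suc)

lemma fsubst_Len [simp]: "fsubst \<sigma> (Len p n) = Len (tsubst \<sigma> p) (tsubst \<sigma> n)"
  by (simp add: Len_def)

lemma fsubst_HasProg [simp]: "fsubst \<sigma> (HasProg D x n) = HasProg D (tsubst \<sigma> x) (tsubst \<sigma> n)"
  by (simp add: HasProg_def)

lemma fsubst_CEq [simp]: "fsubst \<sigma> (CEq D x n) = CEq D (tsubst \<sigma> x) (tsubst \<sigma> n)"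
  by (simp add: CEq_def)


section \<open>Derived rules\<close>

lemma prv_mono: "\<Gamma> \<turnstile> \<phi> \<Longrightarrow> \<Gamma> \<subseteq> \<Delta> \<Longrightarrow> \<Delta> \<turnstile> \<phi>"
proof (induction arbitrary: \<Delta> rule: prv.induct)
  case (contr \<phi> \<Gamma>)
  show ?case by (rule prv.contr, rule contr.IH) (use contr.prems in auto)
next
  case (impI \<phi> \<Gamma> \<psi>)
  show ?case by (rule prv.impI, rule impI.IH) (use impI.prems in auto)
next
  case (allI \<Gamma> \<phi>)
  show ?case by (rule prv.allI, rule allI.IH) (use allI.prems in auto)
qed (blast intro: prv.intros)+

text \<open>Specialised to the shift, this moves a derivation under a binder. For
  \<open>allI\<close> the induction hypothesis is taken at \<open>up \<sigma>\<close>, which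
  commutes with the shift of the context.\<close>

lemma prv_fsubst: "\<Gamma> \<turnstile> \<phi> \<Longrightarrow> fsubst \<sigma> ` \<Gamma> \<turnstile> fsubst \<sigma> \<phi>"
proof (induction arbitrary: \<sigma> rule: prv.induct)
  case (contr \<phi> \<Gamma>)
  show ?case by (rule prv.contr) (use contr.IH[of \<sigma>] in simp)
next
  case (impI \<phi> \<Gamma> \<psi>)
  show ?case using impI.IH[of \<sigma>] by (simp add: prv.impI)
next
  case (allI \<Gamma> \<phi>)
  have "fsubst (up \<sigma>) ` flift ` \<Gamma> = flift ` fsubst \<sigma> ` \<Gamma>"
    by (auto simp: image_iff fsubst_flift)
  with allI.IH[of "up \<sigma>"] show ?case by (simp add: prv.allI)
next
  case (allE \<Gamma> \<phi> t)
  then show ?case by (auto simp: fsubst_inst intro: prv.allE)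
next
  case (eq_subst \<Gamma> s t \<phi>)
  then show ?case by (auto simp: fsubst_inst intro: prv.eq_subst)
qed (auto intro: prv.intros)

lemma prv_flift: "\<Gamma> \<turnstile> \<phi> \<Longrightarrow> flift ` \<Gamma> \<turnstile> flift \<phi>"
  using prv_fsubst[of \<Gamma> \<phi>] by (simp add: flift_def[abs_def])

lemma prv_cut: "\<Gamma> \<turnstile> \<phi> \<Longrightarrow> insert \<phi> \<Gamma> \<turnstile> \<psi> \<Longrightarrow> \<Gamma> \<turnstile> \<psi>"
  by (meson impE impI)

lemma prv_insert: "\<Gamma> \<turnstile> \<phi> \<Longrightarrow> insert \<psi> \<Gamma> \<turnstile> \<phi>"
  by (rule prv_mono) auto

lemma prv_assm0: "insert \<phi> \<Gamma> \<turnstile> \<phi>"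
  by (rule assm) simp

lemma prv_FlsE: "\<Gamma> \<turnstile> Fls \<Longrightarrow> \<Gamma> \<turnstile> \<phi>"
  by (rule contr) (rule prv_insert)

section \<open>Rules for the defined connectives and the existential quantifier\<close>

lemma prv_NegI: "insert \<phi> \<Gamma> \<turnstile> Fls \<Longrightarrow> \<Gamma> \<turnstile> Neg \<phi>"
  by (simp add: Neg_def impI)

lemma prv_NegE: "\<Gamma> \<turnstile> Neg \<phi> \<Longrightarrow> \<Gamma> \<turnstile> \<phi> \<Longrightarrow> \<Gamma> \<turnstile> \<psi>"
  unfolding Neg_def by (rule prv_FlsE) (rule impE)

text \<open>Classical reasoning enters through \<open>contr\<close>: under \<open>Neg \<psi>\<close>
  the first premise refutes \<open>\<phi>\<close>, and then the second gives
  \<open>\<psi>\<close>.\<close>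

lemma prv_cases: "insert \<phi> \<Gamma> \<turnstile> \<psi> \<Longrightarrow> insert (Neg \<phi>) \<Gamma> \<turnstile> \<psi> \<Longrightarrow> \<Gamma> \<turnstile> \<psi>"
proof -
  assume 1: "insert \<phi> \<Gamma> \<turnstile> \<psi>" and 2: "insert (Neg \<phi>) \<Gamma> \<turnstile> \<psi>"
  have "insert (Neg \<psi>) \<Gamma> \<turnstile> Neg \<phi>"
    by (rule prv_NegI, rule prv_NegE[of _ \<psi>])
      (auto intro: assm prv_mono[OF 1])
  moreover have "insert (Neg \<phi>) (insert (Neg \<psi>) \<Gamma>) \<turnstile> \<psi>"
    by (rule prv_mono[OF 2]) auto
  ultimately have "insert (Neg \<psi>) \<Gamma> \<turnstile> \<psi>"
    by (rule prv_cut)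
  then show "\<Gamma> \<turnstile> \<psi>"
    by (meson contr prv_NegE prv_assm0)
qed

lemma prv_ConjI: "\<Gamma> \<turnstile> \<phi> \<Longrightarrow> \<Gamma> \<turnstile> \<psi> \<Longrightarrow> \<Gamma> \<turnstile> \<phi> \<and>\<^sub>F \<psi>"
  unfolding Conj_def
  by (rule prv_NegI, rule prv_NegE[of _ \<psi>], rule impE[of _ \<phi>])
    (auto intro: prv_insert prv_assm0)

lemma prv_ConjD1: "\<Gamma> \<turnstile> \<phi> \<and>\<^sub>F \<psi> \<Longrightarrow> \<Gamma> \<turnstile> \<phi>"
  unfolding Conj_def
  by (rule contr, rule prv_NegE, erule prv_insert, rule impI, rule prv_NegE[of _ \<phi>])
    (auto intro: assm)

lemma prv_ConjD2: "\<Gamma> \<turnstile> \<phi> \<and>\<^sub>F \<psi> \<Longrightarrow> \<Gamma> \<turnstile> \<psi>"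
  unfolding Conj_def
  by (rule contr, rule prv_NegE, erule prv_insert, rule impI) (auto intro: assm)

lemma prv_DisjI2: "\<Gamma> \<turnstile> \<psi> \<Longrightarrow> \<Gamma> \<turnstile> \<phi> \<or>\<^sub>F \<psi>"
  unfolding Disj_def by (rule impI) (rule prv_insert)

lemma prv_ExiI: "\<Gamma> \<turnstile> inst \<phi> t \<Longrightarrow> \<Gamma> \<turnstile> Exi \<phi>"
  unfolding Exi_def
  by (rule prv_NegI, rule prv_NegE[of _ "inst \<phi> t"])
    (use allE[OF prv_assm0, of "Neg \<phi>" \<Gamma> t] in \<open>auto simp: inst_def intro: prv_insert\<close>)

text \<open>\<open>Exi\<close> is a negated \<open>All\<close>: under \<open>Neg \<chi>\<close> the
  second premise refutes the body for the fresh witness \<open>Var 0\<close>, and generalising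
  contradicts the first premise.\<close>

lemma prv_ExiE:
  assumes "\<Gamma> \<turnstile> Exi \<phi>" "insert \<phi> (flift ` \<Gamma>) \<turnstile> flift \<chi>"
  shows "\<Gamma> \<turnstile> \<chi>"
proof (rule contr)
  have [simp]: "flift (Neg \<chi>) = Neg (flift \<chi>)"
    by (simp add: flift_def)
  have "insert \<phi> (flift ` insert (Neg \<chi>) \<Gamma>) \<turnstile> Fls"
    by (rule prv_NegE[of _ "flift \<chi>"])
      (auto intro: assm prv_mono[OF assms(2)])
  then have "insert (Neg \<chi>) \<Gamma> \<turnstile> All (Neg \<phi>)"
    by (intro allI prv_NegI)
  with assms(1) show "insert (Neg \<chi>) \<Gamma> \<turnstile> Fls"
    unfolding Exi_def by (blast intro: prv_NegE prv_insert)
qed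

text \<open>Converse of \<open>allI\<close>: the bound variable becomes the fresh parameter
  \<open>Var 0\<close>.\<close>

lemma prv_AllD_Var0: "\<Gamma> \<turnstile> All \<phi> \<Longrightarrow> flift ` \<Gamma> \<turnstile> \<phi>"
  using allE[of "flift ` \<Gamma>" "fsubst (up (\<lambda>i. Var (Suc i))) \<phi>" "Var 0"] prv_flift[of \<Gamma> "All \<phi>"]
  by (simp add: inst_up_Suc_Var0 flift_def)

section \<open>Equality reasoning\<close>

lemma prv_eq_sym: "\<Gamma> \<turnstile> s \<doteq> t \<Longrightarrow> \<Gamma> \<turnstile> t \<doteq> s"
  \<comment> \<open>In the templates for \<open>eq_subst\<close>, \<open>Var 0\<close> marks the
    place to rewrite and \<open>tlift 1\<close> shields the other terms.\<close>
  using eq_subst[of \<Gamma> s t "Var 0 \<doteq> tlift 1 s"] by (simp add: inst_def eq_refl)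

lemma prv_eq_trans [trans]: "\<Gamma> \<turnstile> r \<doteq> s \<Longrightarrow> \<Gamma> \<turnstile> s \<doteq> t \<Longrightarrow> \<Gamma> \<turnstile> r \<doteq> t"
  using eq_subst[of \<Gamma> s t "tlift 1 r \<doteq> Var 0"] by (simp add: inst_def)

lemma prv_Sc_cong: "\<Gamma> \<turnstile> s \<doteq> t \<Longrightarrow> \<Gamma> \<turnstile> Sc s \<doteq> Sc t"
  using eq_subst[of \<Gamma> s t "Sc (tlift 1 s) \<doteq> Sc (Var 0)"] by (simp add: inst_def eq_refl)

lemma prv_Add_cong: "\<Gamma> \<turnstile> s \<doteq> s' \<Longrightarrow> \<Gamma> \<turnstile> t \<doteq> t' \<Longrightarrow> \<Gamma> \<turnstile> Add s t \<doteq> Add s' t'"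
  using eq_subst[of \<Gamma> s s' "Add (tlift 1 s) (tlift 1 t) \<doteq> Add (Var 0) (tlift 1 t)"]
    eq_subst[of \<Gamma> t t' "Add (tlift 1 s) (tlift 1 t) \<doteq> Add (tlift 1 s') (Var 0)"]
  by (simp add: inst_def eq_refl)

lemma prv_Mul_cong: "\<Gamma> \<turnstile> s \<doteq> s' \<Longrightarrow> \<Gamma> \<turnstile> t \<doteq> t' \<Longrightarrow> \<Gamma> \<turnstile> Mul s t \<doteq> Mul s' t'"
  using eq_subst[of \<Gamma> s s' "Mul (tlift 1 s) (tlift 1 t) \<doteq> Mul (Var 0) (tlift 1 t)"]
    eq_subst[of \<Gamma> t t' "Mul (tlift 1 s) (tlift 1 t) \<doteq> Mul (tlift 1 s') (Var 0)"]
  by (simp add: inst_def eq_refl)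

text \<open>Serves the chain condition of Zorn's lemma. Rules that discharge a formula delete it
  from the finite set; at \<open>allI\<close>, a finite set of shifted hypotheses is the shift of a
  finite set.\<close>

lemma prv_compact: "\<Gamma> \<turnstile> \<phi> \<Longrightarrow> \<exists>\<Delta> \<subseteq> \<Gamma>. finite \<Delta> \<and> \<Delta> \<turnstile> \<phi>"
proof (induction rule: prv.induct)
  case (assm \<phi> \<Gamma>)
  then show ?case by (intro exI[of _ "{\<phi>}"]) (auto intro: prv.assm)
next
  case (contr \<phi> \<Gamma>)
  then obtain \<Delta> where \<Delta>: "\<Delta> \<subseteq> insert (Neg \<phi>) \<Gamma>" "finite \<Delta>" "\<Delta> \<turnstile> Fls" by blast
  have "insert (Neg \<phi>) (\<Delta> - {Neg \<phi>}) \<turnstile> Fls" by (rule prv_mono[OF \<Delta>(3)]) auto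
  with \<Delta> show ?case by (intro exI[of _ "\<Delta> - {Neg \<phi>}"]) (auto intro: prv.contr)
next
  case (impI \<phi> \<Gamma> \<psi>)
  then obtain \<Delta> where \<Delta>: "\<Delta> \<subseteq> insert \<phi> \<Gamma>" "finite \<Delta>" "\<Delta> \<turnstile> \<psi>" by blast
  have "insert \<phi> (\<Delta> - {\<phi>}) \<turnstile> \<psi>" by (rule prv_mono[OF \<Delta>(3)]) auto
  with \<Delta> show ?case by (intro exI[of _ "\<Delta> - {\<phi>}"]) (auto intro: prv.impI)
next
  case (impE \<Gamma> \<phi> \<psi>)
  then obtain \<Delta> \<Delta>' where "\<Delta> \<subseteq> \<Gamma>" "finite \<Delta>" "\<Delta> \<turnstile> \<phi> \<rightarrow>\<^sub>F \<psi>" "\<Delta>' \<subseteq> \<Gamma>" "finite \<Delta>'" "\<Delta>' \<turnstile> \<phi>"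
    by blast
  then show ?case
    by (intro exI[of _ "\<Delta> \<union> \<Delta>'"]) (auto intro: prv.impE[of _ \<phi>] prv_mono)
next
  case (allI \<Gamma> \<phi>)
  then obtain \<Delta> where "\<Delta> \<subseteq> flift ` \<Gamma>" "finite \<Delta>" "\<Delta> \<turnstile> \<phi>" by blast
  then show ?case by (metis finite_subset_image prv.allI)
next
  case (allE \<Gamma> \<phi> t)
  then show ?case by (blast intro: prv.allE)
next
  case (eq_refl \<Gamma> t)
  show ?case by (intro exI[of _ "{}"]) (auto intro: prv.eq_refl)
next
  case (eq_subst \<Gamma> s t \<phi>)
  then obtain \<Delta> \<Delta>' where
    "\<Delta> \<subseteq> \<Gamma>" "finite \<Delta>" "\<Delta> \<turnstile> s \<doteq> t" "\<Delta>' \<subseteq> \<Gamma>" "finite \<Delta>'" "\<Delta>' \<turnstile> inst \<phi> s"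
    by blast
  then show ?case
    by (intro exI[of _ "\<Delta> \<union> \<Delta>'"]) (auto intro: prv.eq_subst[of _ s] prv_mono)
qed


section \<open>Maximal consistent sets\<close>

text \<open>Zorn's lemma on the consistent supersets of \<open>\<Gamma>\<close>. Open formulas are
  decided too, their free variables being parameters.\<close>

lemma Lindenbaum:
  assumes "\<not> \<Gamma> \<turnstile> Fls"
  obtains T where "\<Gamma> \<subseteq> T" "\<not> T \<turnstile> Fls" "\<And>\<phi>. \<phi> \<in> T \<or> Neg \<phi> \<in> T"
proof -
  define A where "A = {\<Delta>. \<Gamma> \<subseteq> \<Delta> \<and> \<not> \<Delta> \<turnstile> Fls}"
  \<comment> \<open>A nonempty chain is bounded by its union: by compactness an inconsistency would
    already lie in one member.\<close>
  have "\<exists>U \<in> A. \<forall>X \<in> C. X \<subseteq> U" if C: "subset.chain A C" for C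
  proof (cases "C = {}")
    case True
    then show ?thesis using assms by (auto simp: A_def)
  next
    case False
    have "\<not> \<Union>C \<turnstile> Fls"
    proof
      assume "\<Union>C \<turnstile> Fls"
      then obtain \<Delta> where \<Delta>: "\<Delta> \<subseteq> \<Union>C" "finite \<Delta>" "\<Delta> \<turnstile> Fls"
        using prv_compact by blast
      obtain X where "X \<in> C" "\<Delta> \<subseteq> X"
        using finite_subset_Union_chain[OF \<Delta>(2,1) False C] .
      with C \<Delta>(3) show False
        unfolding A_def subset.chain_def by (auto dest: prv_mono)
    qed
    moreover have "\<Gamma> \<subseteq> \<Union>C"
      using C False unfolding A_def subset.chain_def by fast
    ultimately show ?thesis by (intro bexI[of _ "\<Union>C"]) (auto simp: A_def)
  qed
  then obtain T where T: "T \<in> A" "\<And>X. X \<in> A \<Longrightarrow> T \<subseteq> X \<Longrightarrow> X = T"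
    using subset_Zorn[of A] by metis
  \<comment> \<open>Otherwise maximality makes both one-formula extensions inconsistent, and then so
    is \<open>T\<close> by case distinction.\<close>
  have "\<phi> \<in> T \<or> Neg \<phi> \<in> T" for \<phi>
  proof (rule ccontr)
    assume "\<not> (\<phi> \<in> T \<or> Neg \<phi> \<in> T)"
    then have "insert \<phi> T \<notin> A" "insert (Neg \<phi>) T \<notin> A"
      using T(2) by blast+
    then have "insert \<phi> T \<turnstile> Fls" "insert (Neg \<phi>) T \<turnstile> Fls"
      using T(1) by (auto simp: A_def)
    then have "T \<turnstile> Fls" by (rule prv_cases)
    with T(1) show False by (simp add: A_def)
  qed
  with T(1) show thesis by (intro that[of T]) (auto simp: A_def)
qed


section \<open>Soundness\<close>

lemma sat_fsubst: "sat e (fsubst \<sigma> \<phi>) \<longleftrightarrow> sat (\<lambda>i. tval e (\<sigma> i)) \<phi>"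
proof (induction \<phi> arbitrary: e \<sigma>)
  case (All \<phi>)
  have "(\<lambda>i. tval (case_nat x e) (up \<sigma> i)) = case_nat x (\<lambda>i. tval e (\<sigma> i))" for x
    by (rule ext) (simp add: up_def split: nat.split)
  with All show ?case by simp
qed (auto simp: tval_tsubst)

lemma sat_inst: "sat e (inst \<phi> t) \<longleftrightarrow> sat (case_nat (tval e t) e) \<phi>"
proof -
  have "(\<lambda>i. tval e (case_nat t Var i)) = case_nat (tval e t) e"
    by (rule ext) (simp split: nat.split)
  then show ?thesis by (simp add: inst_def sat_fsubst)
qed

text \<open>One valuation serves hypotheses and conclusion because free variables are parameters. It
  varies in the induction: \<open>allI\<close> extends it by each \<open>x\<close>, where shifted
  hypotheses keep their truth values.\<close>

lemma prv_sound: "\<Gamma> \<turnstile> \<phi> \<Longrightarrow> (\<And>\<gamma>. \<gamma> \<in> \<Gamma> \<Longrightarrow> sat e \<gamma>) \<Longrightarrow> sat e \<phi>"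
proof (induction arbitrary: e rule: prv.induct)
  case (contr \<phi> \<Gamma>)
  then show ?case by (metis insert_iff sat.simps(1) sat_connectives(1))
next
  case (allI \<Gamma> \<phi>)
  show ?case
  proof (simp, rule)
    show "sat (case_nat x e) \<phi>" for x
      by (rule allI.IH) (use allI.prems in \<open>auto simp: flift_def sat_fsubst\<close>)
  qed
next
  case (eq_subst \<Gamma> s t \<phi>)
  then show ?case by (metis sat.simps(2) sat_inst)
qed (auto simp: sat_inst)

lemma sat_induction_fm: "sat e (induction_fm \<phi>)"
proof -
  have "sat (case_nat x e) \<phi>"
    if "sat (case_nat 0 e) \<phi>" "\<And>x. sat (case_nat x e) \<phi> \<Longrightarrow> sat (case_nat (Suc x) e) \<phi>" for x
    using that by (induction x) auto
  moreover have "(\<lambda>i. tval (case_nat x e) (case_nat (Sc (Var 0)) (\<lambda>i. Var (Suc i)) i)) =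
      case_nat (Suc x) e" for x
    by (rule ext) (simp split: nat.split)
  ultimately show ?thesis
    by (auto simp: induction_fm_def sat_inst sat_fsubst)
qed

lemma sat_All_funpow: "(\<And>e. sat e \<phi>) \<Longrightarrow> sat e ((All ^^ k) \<phi>)"
  by (induction k arbitrary: e) auto

lemma sat_PA: "\<phi> \<in> PA \<Longrightarrow> sat e \<phi>"
  by (induction rule: PA.induct) (auto intro: sat_All_funpow sat_induction_fm)

text \<open>Carries provable optimality over to the standard model.\<close>

lemma PA_sound: "PA \<turnstile> \<phi> \<Longrightarrow> sat e \<phi>"
  by (rule prv_sound) (auto intro: sat_PA)


section \<open>Arithmetic in PA\<close>

text \<open>The axioms are sentences, induction axioms being closed by their \<open>k\<close>
  quantifiers; hence \<open>PA\<close> stays available under binders.\<close>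

lemma flift_PA: "\<phi> \<in> PA \<Longrightarrow> flift \<phi> = \<phi>"
proof -
  have *: "fbelow j ((All ^^ k) \<phi>) \<longleftrightarrow> fbelow (j + k) \<phi>" for j k \<phi>
    by (induction k arbitrary: j) auto
  assume "\<phi> \<in> PA"
  then have "fbelow 0 \<phi>"
    by (induction rule: PA.induct) (auto simp: * Neg_def)
  then show ?thesis unfolding flift_def by (rule fsubst_closed_below) simp
qed

lemma PA_subset_flift: "PA \<subseteq> \<Gamma> \<Longrightarrow> PA \<subseteq> flift ` \<Gamma>"
  by (metis flift_PA image_eqI subset_iff)

lemma inst_simps [simp]:
  "inst (r \<doteq> s) t = (tsubst (case_nat t Var) r \<doteq> tsubst (case_nat t Var) s)"
  "inst (\<phi> \<rightarrow>\<^sub>F \<psi>) t = (inst \<phi> t \<rightarrow>\<^sub>F inst \<psi> t)"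
  "inst (\<phi> \<and>\<^sub>F \<psi>) t = (inst \<phi> t \<and>\<^sub>F inst \<psi> t)"
  "inst (Neg \<phi>) t = Neg (inst \<phi> t)"
  "inst (All \<phi>) t = All (fsubst (up (case_nat t Var)) \<phi>)"
  "inst (Exi \<phi>) t = Exi (fsubst (up (case_nat t Var)) \<phi>)"
  "inst (Le r s) t = Le (tsubst (case_nat t Var) r) (tsubst (case_nat t Var) s)"
  "inst (Lt r s) t = Lt (tsubst (case_nat t Var) r) (tsubst (case_nat t Var) s)"
  "inst (HasProg D r s) t = HasProg D (tsubst (case_nat t Var) r) (tsubst (case_nat t Var) s)"
  "inst (CEq D r s) t = CEq D (tsubst (case_nat t Var) r) (tsubst (case_nat t Var) s)"
  by (simp_all add: inst_def)

lemma flift_simps [simp]: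
  "flift Fls = Fls"
  "flift (r \<doteq> s) = (tlift 1 r \<doteq> tlift 1 s)"
  "flift (Neg \<phi>) = Neg (flift \<phi>)"
  "flift (Le r s) = Le (tlift 1 r) (tlift 1 s)"
  "flift (Lt r s) = Lt (tlift 1 r) (tlift 1 s)"
  "flift (CEq D r s) = CEq D (tlift 1 r) (tlift 1 s)"
  by (simp_all add: flift_def tlift_def)

section \<open>The axioms as rules over any context containing \<open>PA\<close>\<close>

context
  fixes \<Gamma> :: "fm set"
  assumes PA: "PA \<subseteq> \<Gamma>"
begin

lemma PA_prv: "\<phi> \<in> PA \<Longrightarrow> \<Gamma> \<turnstile> \<phi>"
  using PA by (auto intro: assm)

lemma prv_Sc_neq_Zero: "\<Gamma> \<turnstile> Neg (Sc t \<doteq> Zero)"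
  using allE[OF PA_prv[OF PA.intros(1)], of t] by simp

lemma prv_Sc_inject: "\<Gamma> \<turnstile> Sc s \<doteq> Sc t \<Longrightarrow> \<Gamma> \<turnstile> s \<doteq> t"
  \<comment> \<open>The outer quantifier binds \<open>Var 1\<close>, so \<open>t\<close> is supplied
    before \<open>s\<close>.\<close>
  using allE[OF allE[OF PA_prv[OF PA.intros(2)], of t, simplified], of s]
  by (auto intro: impE)

lemma prv_Add_Zero: "\<Gamma> \<turnstile> Add t Zero \<doteq> t"
  using allE[OF PA_prv[OF PA.intros(3)], of t] by simp

lemma prv_Add_Sc: "\<Gamma> \<turnstile> Add s (Sc t) \<doteq> Sc (Add s t)"
  using allE[OF allE[OF PA_prv[OF PA.intros(4)], of t, simplified], of s] by simp

lemma prv_Mul_Zero: "\<Gamma> \<turnstile> Mul t Zero \<doteq> Zero"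
  using allE[OF PA_prv[OF PA.intros(5)], of t] by simp

lemma prv_Mul_Sc: "\<Gamma> \<turnstile> Mul s (Sc t) \<doteq> Add (Mul s t) s"
  using allE[OF allE[OF PA_prv[OF PA.intros(6)], of t, simplified], of s] by simp

end

lemma flift_image_PA: "flift ` PA = PA"
  by (force simp: flift_PA image_iff)

text \<open>Shifting does not change \<open>PA\<close>, so stripping quantifiers keeps the context.
  Applied to an induction axiom, this yields its open instance.\<close>

lemma PA_AllD: "PA \<turnstile> (All ^^ k) \<phi> \<Longrightarrow> PA \<turnstile> \<phi>"
proof (induction k)
  case (Suc k)
  then show ?case using prv_AllD_Var0[of PA "(All ^^ k) \<phi>"] by (simp add: flift_image_PA)
qed simp

text \<open>The open instance is weakened to \<open>\<Gamma>\<close>, so the induction formula may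
  share parameters with the hypotheses.\<close>

lemma prv_induction:
  assumes "PA \<subseteq> \<Gamma>" "fbelow k (induction_fm \<phi>)" "\<Gamma> \<turnstile> inst \<phi> Zero"
    and "insert \<phi> (flift ` \<Gamma>) \<turnstile> fsubst (case_nat (Sc (Var 0)) (\<lambda>i. Var (Suc i))) \<phi>"
  shows "\<Gamma> \<turnstile> All \<phi>"
proof -
  have "PA \<turnstile> induction_fm \<phi>"
    using assms(2) by (rule PA_AllD[OF assm[OF PA.intros(7)]])
  then have "\<Gamma> \<turnstile> induction_fm \<phi>"
    using assms(1) by (rule prv_mono)
  from impE[OF impE[OF this[unfolded induction_fm_def] assms(3)] allI[OF impI[OF assms(4)]]]
  show ?thesis .
qed

text \<open>Addition recurses on the right, whereas \<open>Lt\<close> puts the successor on the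
  left. Induction on the right summand bridges this for the order facts below.\<close>

lemma prv_Sc_Add:
  assumes "PA \<subseteq> \<Gamma>"
  shows "\<Gamma> \<turnstile> Add (Sc s) t \<doteq> Sc (Add s t)"
proof -
  \<comment> \<open>The parameter \<open>Var 1\<close> stands for \<open>s\<close>, so a single
    quantifier closes the induction axiom whatever variables \<open>s\<close> contains.\<close>
  define \<phi> where "\<phi> = (Add (Sc (Var 1)) (Var 0) \<doteq> Sc (Add (Var 1) (Var 0)))"
  have "flift ` \<Gamma> \<turnstile> All \<phi>"
  proof (rule prv_induction[where k = 1])
    show PA: "PA \<subseteq> flift ` \<Gamma>" by (rule PA_subset_flift) fact
    show "fbelow 1 (induction_fm \<phi>)"
      by (simp add: induction_fm_def \<phi>_def)
    show "flift ` \<Gamma> \<turnstile> inst \<phi> Zero"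
      unfolding \<phi>_def
      by (simp, rule prv_eq_trans[OF prv_Add_Zero[OF PA] prv_eq_sym])
        (rule prv_Sc_cong, rule prv_Add_Zero[OF PA])
    let ?\<Delta> = "insert \<phi> (flift ` flift ` \<Gamma>)"
    have PA': "PA \<subseteq> ?\<Delta>" using PA_subset_flift[OF PA] by blast
    have "?\<Delta> \<turnstile> Add (Sc (Var 1)) (Sc (Var 0)) \<doteq> Sc (Add (Sc (Var 1)) (Var 0))"
      by (rule prv_Add_Sc[OF PA'])
    also have "?\<Delta> \<turnstile> Sc (Add (Sc (Var 1)) (Var 0)) \<doteq> Sc (Sc (Add (Var 1) (Var 0)))"
      by (rule prv_Sc_cong) (simp add: \<phi>_def[symmetric] prv_assm0 del: One_nat_def)
    also have "?\<Delta> \<turnstile> Sc (Sc (Add (Var 1) (Var 0))) \<doteq> Sc (Add (Var 1) (Sc (Var 0)))"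
      by (rule prv_Sc_cong, rule prv_eq_sym, rule prv_Add_Sc[OF PA'])
    finally show "?\<Delta> \<turnstile> fsubst (case_nat (Sc (Var 0)) (\<lambda>i. Var (Suc i))) \<phi>"
      by (simp add: \<phi>_def)
  qed
  then have "\<Gamma> \<turnstile> All (All \<phi>)" by (rule allI)
  from allE[OF allE[OF this, of s, unfolded inst_simps], of t] show ?thesis
    by (simp add: \<phi>_def)
qed

text \<open>Induction inside PA gives a nonzero number a predecessor, which enters as the fresh
  parameter \<open>Var 0\<close>.\<close>

lemma prv_nat_cases:
  assumes PA: "PA \<subseteq> \<Gamma>" and 0: "insert (t \<doteq> Zero) \<Gamma> \<turnstile> \<chi>"
    and Suc: "insert (tlift 1 t \<doteq> Sc (Var 0)) (flift ` \<Gamma>) \<turnstile> flift \<chi>"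
  shows "\<Gamma> \<turnstile> \<chi>"
proof (rule prv_cases[OF 0])
  define \<phi> where "\<phi> = (Neg (Var 0 \<doteq> Zero) \<rightarrow>\<^sub>F Exi (Var 1 \<doteq> Sc (Var 0)))"
  have "\<Gamma> \<turnstile> All \<phi>"
  proof (rule prv_induction[OF PA, where k = 0])
    show "fbelow 0 (induction_fm \<phi>)"
      by (simp add: induction_fm_def \<phi>_def inst_def Neg_def Exi_def)
    show "\<Gamma> \<turnstile> inst \<phi> Zero"
      unfolding \<phi>_def by (simp, rule impI, rule prv_NegE[OF prv_assm0 eq_refl])
    show "insert \<phi> (flift ` \<Gamma>) \<turnstile> fsubst (case_nat (Sc (Var 0)) (\<lambda>i. Var (Suc i))) \<phi>"
      \<comment> \<open>The predecessor of the successor is the induction variable itself.\<close>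
      unfolding \<phi>_def by (simp, rule impI, rule prv_ExiI[of _ _ "Var 0"]) (simp add: eq_refl)
  qed
  from allE[OF this, of t] have "\<Gamma> \<turnstile> Neg (t \<doteq> Zero) \<rightarrow>\<^sub>F Exi (tlift 1 t \<doteq> Sc (Var 0))"
    by (simp add: \<phi>_def)
  then have "insert (Neg (t \<doteq> Zero)) \<Gamma> \<turnstile> Exi (tlift 1 t \<doteq> Sc (Var 0))"
    by (rule impE[OF prv_insert prv_assm0])
  then show "insert (Neg (t \<doteq> Zero)) \<Gamma> \<turnstile> \<chi>"
    by (rule prv_ExiE) (rule prv_mono[OF Suc], auto)
qed

section \<open>The order relation\<close>

lemma prv_LeI: "\<Gamma> \<turnstile> Add s u \<doteq> t \<Longrightarrow> \<Gamma> \<turnstile> Le s t"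
  unfolding Le_def by (rule prv_ExiI[of _ _ u]) simp

lemma prv_LeE:
  assumes "\<Gamma> \<turnstile> Le s t" "insert (Add (tlift 1 s) (Var 0) \<doteq> tlift 1 t) (flift ` \<Gamma>) \<turnstile> flift \<chi>"
  shows "\<Gamma> \<turnstile> \<chi>"
  using assms unfolding Le_def by (rule prv_ExiE)

lemma PA_subset_insert_flift: "PA \<subseteq> \<Gamma> \<Longrightarrow> PA \<subseteq> insert \<phi> (flift ` \<Gamma>)"
  using PA_subset_flift by blast

lemma prv_Le_imp_Lt_Sc:
  assumes "PA \<subseteq> \<Gamma>" "\<Gamma> \<turnstile> Le s t"
  shows "\<Gamma> \<turnstile> Lt s (Sc t)"
proof (rule prv_LeE[OF assms(2)])
  let ?\<Delta> = "insert (Add (tlift 1 s) (Var 0) \<doteq> tlift 1 t) (flift ` \<Gamma>)"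
  have PA: "PA \<subseteq> ?\<Delta>" by (rule PA_subset_insert_flift) fact
  have "?\<Delta> \<turnstile> Add (Sc (tlift 1 s)) (Var 0) \<doteq> Sc (Add (tlift 1 s) (Var 0))"
    by (rule prv_Sc_Add[OF PA])
  also have "?\<Delta> \<turnstile> Sc (Add (tlift 1 s) (Var 0)) \<doteq> Sc (tlift 1 t)"
    by (rule prv_Sc_cong, rule prv_assm0)
  finally show "?\<Delta> \<turnstile> flift (Lt s (Sc t))"
    unfolding flift_simps tlift_simps Lt_def by (rule prv_LeI)
qed

lemma prv_Lt_Sc_Sc:
  assumes "PA \<subseteq> \<Gamma>" "\<Gamma> \<turnstile> Lt (Sc s) (Sc t)"
  shows "\<Gamma> \<turnstile> Lt s t"
proof (rule prv_LeE[OF assms(2)[unfolded Lt_def]])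
  let ?\<Delta> = "insert (Add (tlift 1 (Sc (Sc s))) (Var 0) \<doteq> tlift 1 (Sc t)) (flift ` \<Gamma>)"
  have PA: "PA \<subseteq> ?\<Delta>" by (rule PA_subset_insert_flift) fact
  have "?\<Delta> \<turnstile> Sc (Add (Sc (tlift 1 s)) (Var 0)) \<doteq> Add (Sc (Sc (tlift 1 s))) (Var 0)"
    by (rule prv_eq_sym, rule prv_Sc_Add[OF PA])
  also have "?\<Delta> \<turnstile> Add (Sc (Sc (tlift 1 s))) (Var 0) \<doteq> Sc (tlift 1 t)"
    by (simp add: prv_assm0)
  finally have "?\<Delta> \<turnstile> Add (Sc (tlift 1 s)) (Var 0) \<doteq> tlift 1 t"
    by (rule prv_Sc_inject[OF PA])
  then show "?\<Delta> \<turnstile> flift (Lt s t)"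
    unfolding flift_simps tlift_simps Lt_def by (rule prv_LeI)
qed

lemma prv_not_Lt_Zero:
  assumes "PA \<subseteq> \<Gamma>" "\<Gamma> \<turnstile> Lt s Zero"
  shows "\<Gamma> \<turnstile> \<phi>"
proof (rule prv_LeE[OF assms(2)[unfolded Lt_def]])
  let ?\<Delta> = "insert (Add (tlift 1 (Sc s)) (Var 0) \<doteq> tlift 1 Zero) (flift ` \<Gamma>)"
  have PA: "PA \<subseteq> ?\<Delta>" by (rule PA_subset_insert_flift) fact
  have "?\<Delta> \<turnstile> Sc (Add (tlift 1 s) (Var 0)) \<doteq> Add (Sc (tlift 1 s)) (Var 0)"
    by (rule prv_eq_sym, rule prv_Sc_Add[OF PA])
  also have "?\<Delta> \<turnstile> Add (Sc (tlift 1 s)) (Var 0) \<doteq> Zero"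
    by (simp add: prv_assm0)
  finally show "?\<Delta> \<turnstile> flift \<phi>"
    by (rule prv_NegE[OF prv_Sc_neq_Zero[OF PA]])
qed

text \<open>This confines values below a standard bound to standard numerals. The induction on
  \<open>n\<close> is outside PA and passes from \<open>t\<close> to its predecessor, so context,
  term and goal are arbitrary.\<close>

lemma prv_Lt_numeral_cases:
  assumes "PA \<subseteq> \<Gamma>" "\<Gamma> \<turnstile> Lt t (numeral_tm n)"
    and "\<And>k. k < n \<Longrightarrow> insert (t \<doteq> numeral_tm k) \<Gamma> \<turnstile> \<chi>"
  shows "\<Gamma> \<turnstile> \<chi>"
  using assms
proof (induction n arbitrary: \<Gamma> t \<chi>)
  case 0
  then show ?case by (auto intro: prv_not_Lt_Zero)
next
  case (Suc n)
  show ?case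
  proof (rule prv_nat_cases[OF Suc.prems(1)])
    show "insert (t \<doteq> Zero) \<Gamma> \<turnstile> \<chi>" using Suc.prems(3)[of 0] by simp
    let ?eq = "tlift 1 t \<doteq> Sc (Var 0)"
    let ?\<Delta> = "insert ?eq (flift ` \<Gamma>)"
    show "?\<Delta> \<turnstile> flift \<chi>"
    proof (rule Suc.IH[where t = "Var 0"])
      show PA: "PA \<subseteq> ?\<Delta>" by (rule PA_subset_insert_flift) fact
      have "?\<Delta> \<turnstile> Lt (tlift 1 t) (Sc (numeral_tm n))"
        using prv_insert[OF prv_flift[OF Suc.prems(2)]] by simp
      then have "?\<Delta> \<turnstile> Lt (Sc (Var 0)) (Sc (numeral_tm n))"
        using eq_subst[of ?\<Delta> "tlift 1 t" "Sc (Var 0)" "Lt (Var 0) (Sc (numeral_tm n))"]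
        by (simp add: prv_assm0)
      then show "?\<Delta> \<turnstile> Lt (Var 0) (numeral_tm n)" by (rule prv_Lt_Sc_Sc[OF PA])
    next
      fix k assume "k < n"
      let ?\<Delta>' = "insert (Var 0 \<doteq> numeral_tm k) ?\<Delta>"
      have "?\<Delta>' \<turnstile> tlift 1 t \<doteq> Sc (Var 0)" by (rule assm) simp
      also have "?\<Delta>' \<turnstile> Sc (Var 0) \<doteq> Sc (numeral_tm k)"
        by (rule prv_Sc_cong, rule prv_assm0)
      finally have "?\<Delta>' \<turnstile> tlift 1 t \<doteq> Sc (numeral_tm k)" .
      \<comment> \<open>Value \<open>k\<close> of the predecessor is the assumed case
        \<open>Suc k\<close> of \<open>t\<close>.\<close>
      moreover have "insert (tlift 1 t \<doteq> Sc (numeral_tm k)) (flift ` \<Gamma>) \<turnstile> flift \<chi>"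
        using prv_flift[OF Suc.prems(3)[of "Suc k"]] \<open>k < n\<close> by simp
      ultimately show "?\<Delta>' \<turnstile> flift \<chi>"
        by (rule prv_cut[OF _ prv_mono]) auto
    qed
  qed
qed

text \<open>Below a numeral only smaller numerals occur, so finitely many instances suffice.\<close>

lemma prv_AllLtI:
  assumes "PA \<subseteq> \<Gamma>" and inst: "\<And>k. k < n \<Longrightarrow> \<Gamma> \<turnstile> inst \<phi> (numeral_tm k)"
  shows "\<Gamma> \<turnstile> AllLt (numeral_tm n) \<phi>"
  unfolding AllLt_def
proof (rule allI, rule impI)
  let ?\<Delta> = "insert (Lt (Var 0) (tlift 1 (numeral_tm n))) (flift ` \<Gamma>)"
  show "?\<Delta> \<turnstile> \<phi>"
  proof (rule prv_Lt_numeral_cases)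
    show "PA \<subseteq> ?\<Delta>" by (rule PA_subset_insert_flift) fact
    show "?\<Delta> \<turnstile> Lt (Var 0) (numeral_tm n)" by (simp add: prv_assm0)
    fix k assume "k < n"
    \<comment> \<open>The instance of \<open>?\<phi>\<close> at the numeral is the shifted
      assumption; its instance at \<open>Var 0\<close> is \<open>\<phi>\<close> again, so
      \<open>eq_subst\<close> applies.\<close>
    let ?\<phi> = "fsubst (up (\<lambda>i. Var (Suc i))) \<phi>"
    let ?\<Delta>' = "insert (Var 0 \<doteq> numeral_tm k) ?\<Delta>"
    have "?\<Delta>' \<turnstile> numeral_tm k \<doteq> Var 0" by (rule prv_eq_sym, rule prv_assm0)
    moreover have "?\<Delta>' \<turnstile> inst ?\<phi> (numeral_tm k)"
      using prv_flift[OF inst[OF \<open>k < n\<close>]]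
      by (intro prv_insert) (simp add: flift_def fsubst_inst)
    ultimately have "?\<Delta>' \<turnstile> inst ?\<phi> (Var 0)" by (rule eq_subst)
    then show "?\<Delta>' \<turnstile> \<phi>" by (simp add: inst_up_Suc_Var0)
  qed
qed


section \<open>Provability of true existential statements\<close>

lemma prv_Add_numeral:
  assumes "PA \<subseteq> \<Gamma>"
  shows "\<Gamma> \<turnstile> Add (numeral_tm m) (numeral_tm n) \<doteq> numeral_tm (m + n)"
proof (induction n)
  case 0
  show ?case using prv_Add_Zero[OF assms] by simp
next
  case (Suc n)
  show ?case using prv_eq_trans[OF prv_Add_Sc[OF assms] prv_Sc_cong[OF Suc]] by simp
qed

lemma prv_Mul_numeral:
  assumes "PA \<subseteq> \<Gamma>"
  shows "\<Gamma> \<turnstile> Mul (numeral_tm m) (numeral_tm n) \<doteq> numeral_tm (m * n)"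
proof (induction n)
  case 0
  show ?case using prv_Mul_Zero[OF assms] by simp
next
  case (Suc n)
  have "\<Gamma> \<turnstile> Mul (numeral_tm m) (numeral_tm (Suc n)) \<doteq>
      Add (Mul (numeral_tm m) (numeral_tm n)) (numeral_tm m)"
    using prv_Mul_Sc[OF assms] by simp
  also have "\<Gamma> \<turnstile> Add (Mul (numeral_tm m) (numeral_tm n)) (numeral_tm m) \<doteq>
      Add (numeral_tm (m * n)) (numeral_tm m)"
    by (rule prv_Add_cong[OF Suc eq_refl])
  also have "\<Gamma> \<turnstile> Add (numeral_tm (m * n)) (numeral_tm m) \<doteq> numeral_tm (m * Suc n)"
    using prv_Add_numeral[OF assms, of "m * n" m] by (simp add: add.commute)
  finally show ?case .
qed

lemma prv_eval:
  assumes "PA \<subseteq> \<Gamma>"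
  shows "\<Gamma> \<turnstile> tsubst (\<lambda>i. numeral_tm (e i)) t \<doteq> numeral_tm (tval e t)"
proof (induction t)
  case (Add s t)
  then show ?case using prv_eq_trans[OF prv_Add_cong prv_Add_numeral[OF assms]] by simp
next
  case (Mul s t)
  then show ?case using prv_eq_trans[OF prv_Mul_cong prv_Mul_numeral[OF assms]] by simp
qed (simp_all add: eq_refl prv_Sc_cong)

text \<open>Bounds are variables, so that substituting numerals yields \<^const>\<open>AllLt\<close> of a numeral.\<close>

inductive sigma1 :: "fm \<Rightarrow> bool" where
  "sigma1 (s \<doteq> t)"
| "sigma1 \<phi> \<Longrightarrow> sigma1 \<psi> \<Longrightarrow> sigma1 (\<phi> \<and>\<^sub>F \<psi>)"
| "sigma1 \<phi> \<Longrightarrow> sigma1 (Exi \<phi>)"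
| "sigma1 \<phi> \<Longrightarrow> sigma1 (AllLt (Var i) \<phi>)"

text \<open>Instantiating with a numeral amounts to extending the valuation, which is the form that
  the induction hypothesis below takes.\<close>

lemma inst_fsubst_up_numeral:
  "inst (fsubst (up (\<lambda>i. numeral_tm (e i))) \<phi>) (numeral_tm x) =
   fsubst (\<lambda>i. numeral_tm (case_nat x e i)) \<phi>"
  unfolding inst_def fsubst_fsubst by (rule fsubst_cong) (simp add: up_def split: nat.split)

text \<open>Sigma-1 completeness: the standard model supplies numerals as existential witnesses, and
  bounded quantifiers reduce to finitely many instances.\<close>

lemma sigma1_complete:
  "sigma1 \<phi> \<Longrightarrow> PA \<subseteq> \<Gamma> \<Longrightarrow> sat e \<phi> \<Longrightarrow> \<Gamma> \<turnstile> fsubst (\<lambda>i. numeral_tm (e i)) \<phi>"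
proof (induction arbitrary: e rule: sigma1.induct)
  case (1 s t)
  have "\<Gamma> \<turnstile> tsubst (\<lambda>i. numeral_tm (e i)) s \<doteq> numeral_tm (tval e t)"
    using prv_eval[OF 1(1), of e s] 1(2) by simp
  then show ?case
    using prv_eval[OF 1(1), of e t] by (auto intro: prv_eq_trans prv_eq_sym)
next
  case (2 \<phi> \<psi>)
  then show ?case by (simp add: prv_ConjI)
next
  case (3 \<phi>)
  from 3(4) obtain x where "sat (case_nat x e) \<phi>" by auto
  then have "\<Gamma> \<turnstile> inst (fsubst (up (\<lambda>i. numeral_tm (e i))) \<phi>) (numeral_tm x)"
    unfolding inst_fsubst_up_numeral using 3 by blast
  then show ?case by (simp add: prv_ExiI)
next
  case (4 \<phi> i)
  then show ?case
    by (auto simp: inst_fsubst_up_numeral intro!: prv_AllLtI)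
qed

lemma sigma1_Lt: "sigma1 (Lt s t)" and sigma1_Le: "sigma1 (Le s t)"
  by (simp_all add: Lt_def Le_def sigma1.intros)

lemma sigma1_Beta: "sigma1 (Beta a b i r)"
  unfolding Beta_def by (intro sigma1.intros sigma1_Lt)

text \<open>The exponent bounds a quantifier, so it is a variable, as \<open>sigma1\<close>
  demands.\<close>

lemma sigma1_Pow2: "sigma1 (Pow2 (Var i) r)"
  unfolding Pow2_def tlift_simps by (intro sigma1.intros sigma1_Beta)

text \<open>For the identity program the graph is a mere equation; the rest is the length
  formula.\<close>

lemma sigma1_HasProg_identity: "sigma1 (HasProg (Proj 0) (Var i) (Var j))"
  unfolding HasProg_def Len_def tlift_simps
  by (simp add: sigma1.intros sigma1_Lt sigma1_Le sigma1_Pow2)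

text \<open>Under the identity interpreter a string is its own program; completeness turns this
  truth into a proof.\<close>

lemma PA_HasProg_identity:
  "PA \<turnstile> HasProg (Proj 0) (numeral_tm (string_code x)) (numeral_tm (length x))"
proof -
  \<comment> \<open>\<open>Var 0\<close> denotes the string and \<open>Var 1\<close> its
    length.\<close>
  define e :: "nat \<Rightarrow> nat" where "e = case_nat (string_code x) (\<lambda>_. length x)"
  have "sat e (HasProg (Proj 0) (Var 0) (Var 1))"
    by (auto simp: sat_HasProg e_def)
  from sigma1_complete[OF sigma1_HasProg_identity subset_refl this] show ?thesis
    by (simp add: e_def)
qed


section \<open>The complexity axioms\<close>

text \<open>By soundness, optimality against the identity holds in the standard model, so some
  program of \<open>D\<close> outputs \<open>x\<close>.\<close>

lemma sat_CEq_exists: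
  assumes "provably_optimal D"
  shows "\<exists>n. \<forall>e. sat e (CEq D (numeral_tm (string_code x)) (numeral_tm n))"
proof -
  obtain c where "PA \<turnstile> CLe D (Proj 0) c"
    using assms by (auto simp: provably_optimal_def)
  from PA_sound[OF this, of "\<lambda>_. 0"]
  \<comment> \<open>As \<open>string_code\<close> is injective, \<open>x\<close> is its only program
    under the identity, whose complexity there is exactly \<open>length x\<close>.\<close>
  have "sat (case_nat (length x) (case_nat (string_code x) (\<lambda>_. 0)))
      (Exi (Le (Var 0) (Add (Var 1) (numeral_tm c)) \<and>\<^sub>F CEq D (Var 2) (Var 0)))"
    using bij_string_code unfolding CLe_def
    by (auto simp: sat_CEq bij_def inj_eq simp del: sat_connectives(4))
  then show ?thesis by (auto simp: sat_CEq)
qed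

text \<open>\<open>T\<close> bounds the complexity by a numeral, so refuting each standard value
  would make it inconsistent.\<close>

lemma maximal_CEq:
  assumes D: "provably_optimal D"
    and T: "PA \<subseteq> T" "\<not> T \<turnstile> Fls" "\<And>\<phi>. \<phi> \<in> T \<or> Neg \<phi> \<in> T"
  shows "\<exists>n. CEq D (numeral_tm (string_code x)) (numeral_tm n) \<in> T"
proof (rule ccontr)
  let ?x = "numeral_tm (string_code x)"
  assume neg: "\<nexists>n. CEq D ?x (numeral_tm n) \<in> T"
  \<comment> \<open>A complete consistent set is deductively closed.\<close>
  have mem: "\<phi> \<in> T" if "T \<turnstile> \<phi>" for \<phi>
    using that T(2,3) by (blast intro: assm prv_NegE)
  \<comment> \<open>Reading \<open>m\<close> off \<open>T\<close> avoids proving in PA that no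
    program shorter than \<open>x\<close> outputs \<open>x\<close>: minimality and completeness put
    the needed negations into \<open>T\<close>.\<close>
  define m where "m = (LEAST m. HasProg (Proj 0) ?x (numeral_tm m) \<in> T)"
  have "HasProg (Proj 0) ?x (numeral_tm (length x)) \<in> T"
    by (rule mem, rule prv_mono[OF PA_HasProg_identity T(1)])
  then have 1: "HasProg (Proj 0) ?x (numeral_tm m) \<in> T"
    unfolding m_def by (rule LeastI)
  have "Neg (HasProg (Proj 0) ?x (numeral_tm k)) \<in> T" if "k < m" for k
    using not_less_Least[OF that[unfolded m_def]] T(3) by blast
  then have "T \<turnstile> AllLt (numeral_tm m) (Neg (HasProg (Proj 0) (tlift 1 ?x) (Var 0)))"
    by (intro prv_AllLtI T(1)) (simp add: assm)
  with 1 have CEq: "T \<turnstile> CEq (Proj 0) ?x (numeral_tm m)"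
    unfolding CEq_def by (blast intro: prv_ConjI assm)
  obtain c where "PA \<turnstile> CLe D (Proj 0) c"
    using D by (auto simp: provably_optimal_def)
  then have CLe: "T \<turnstile> CLe D (Proj 0) c"
    by (rule prv_mono) fact
  have "T \<turnstile> CEq (Proj 0) ?x (numeral_tm m) \<rightarrow>\<^sub>F
      Exi (Le (Var 0) (Add (numeral_tm m) (numeral_tm c)) \<and>\<^sub>F CEq D ?x (Var 0))"
    using allE[OF allE[OF CLe[unfolded CLe_def], of ?x, unfolded inst_simps], of "numeral_tm m"]
    by simp
  from impE[OF this CEq] have "T \<turnstile> Fls"
  proof (rule prv_ExiE)
    let ?\<phi> = "Le (Var 0) (Add (numeral_tm m) (numeral_tm c)) \<and>\<^sub>F CEq D ?x (Var 0)"
    let ?\<Delta> = "insert ?\<phi> (flift ` T)"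
    have PA: "PA \<subseteq> ?\<Delta>" by (rule PA_subset_insert_flift) fact
    have "?\<Delta> \<turnstile> Le (Var 0) (Add (numeral_tm m) (numeral_tm c))"
      by (rule prv_ConjD1, rule prv_assm0)
    then have "?\<Delta> \<turnstile> Le (Var 0) (numeral_tm (m + c))"
      \<comment> \<open>Evaluating the sum makes the bound a numeral, as the case distinction
        requires.\<close>
      using eq_subst[OF prv_Add_numeral[OF PA, of m c], of "Le (Var 1) (Var 0)"] by simp
    then have "?\<Delta> \<turnstile> Lt (Var 0) (numeral_tm (Suc (m + c)))"
      using prv_Le_imp_Lt_Sc[OF PA] by simp
    then have "?\<Delta> \<turnstile> Fls"
    proof (rule prv_Lt_numeral_cases[OF PA])
      fix k
      let ?\<Delta>' = "insert (Var 0 \<doteq> numeral_tm k) ?\<Delta>"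
      have "?\<Delta>' \<turnstile> CEq D ?x (Var 0)"
        by (rule prv_insert, rule prv_ConjD2, rule prv_assm0)
      then have "?\<Delta>' \<turnstile> CEq D ?x (numeral_tm k)"
        using eq_subst[of ?\<Delta>' "Var 0" "numeral_tm k" "CEq D ?x (Var 0)"]
        by (simp add: prv_assm0)
      moreover have "Neg (CEq D ?x (numeral_tm k)) \<in> T"
        using neg T(3) by blast
      \<comment> \<open>Only numerals occur as arguments, so the shift leaves this formula
        unchanged.\<close>
      then have "flift (Neg (CEq D ?x (numeral_tm k))) \<in> flift ` T"
        by (rule imageI)
      then have "?\<Delta>' \<turnstile> Neg (CEq D ?x (numeral_tm k))"
        by (intro assm) simp
      ultimately show "?\<Delta>' \<turnstile> Fls"
        by (blast intro: prv_NegE)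
    qed
    then show "?\<Delta> \<turnstile> flift Fls" by simp
  qed
  with T(2) show False ..
qed

theorem theorem12:
  fixes D :: recf and \<phi> :: fm
  assumes "provably_optimal D"
    and "\<not> PA \<turnstile> \<phi>"
  shows "\<exists>n\<^sub>1 n\<^sub>2 :: bool list \<Rightarrow> nat.
           let F = range (\<lambda>x. two_values_axiom D x (n\<^sub>1 x) (n\<^sub>2 x)) in
             (\<forall>\<psi> \<in> F. true_in_N \<psi>) \<and> \<not> (PA \<union> F) \<turnstile> \<phi>"
proof -
  \<comment> \<open>\<open>\<phi>\<close> may be open: its free variables act as parameters, so its
    negation is adjoined as it stands.\<close>
  have "\<not> insert (Neg \<phi>) PA \<turnstile> Fls"
    using assms(2) by (blast intro: contr)
  then obtain T where T: "insert (Neg \<phi>) PA \<subseteq> T" "\<not> T \<turnstile> Fls" "\<And>\<psi>. \<psi> \<in> T \<or> Neg \<psi> \<in> T"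
    using Lindenbaum by blast
  obtain n\<^sub>1 where n\<^sub>1: "\<And>x e. sat e (CEq D (numeral_tm (string_code x)) (numeral_tm (n\<^sub>1 x)))"
    using sat_CEq_exists[OF assms(1)] by metis
  obtain n\<^sub>2 where n\<^sub>2: "\<And>x. CEq D (numeral_tm (string_code x)) (numeral_tm (n\<^sub>2 x)) \<in> T"
    using maximal_CEq[OF assms(1) _ T(2,3)] T(1) by (metis insert_subset)
  define F where "F = range (\<lambda>x. two_values_axiom D x (n\<^sub>1 x) (n\<^sub>2 x))"
  \<comment> \<open>Truth comes from the first disjunct, membership in \<open>T\<close> from the
    second.\<close>
  have "true_in_N \<psi>" if "\<psi> \<in> F" for \<psi>
    using that n\<^sub>1 by (auto simp: F_def true_in_N_def two_values_axiom_def)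
  moreover have "\<not> (PA \<union> F) \<turnstile> \<phi>"
  proof
    assume "(PA \<union> F) \<turnstile> \<phi>"
    have "\<psi> \<in> T" if "\<psi> \<in> F" for \<psi>
    proof -
      have "T \<turnstile> \<psi>"
        using that n\<^sub>2 by (auto simp: F_def two_values_axiom_def intro: prv_DisjI2 assm)
      then show ?thesis using T(2,3) by (blast intro: assm prv_NegE)
    qed
    then have "PA \<union> F \<subseteq> T" using T(1) by auto
    with \<open>(PA \<union> F) \<turnstile> \<phi>\<close> have "T \<turnstile> \<phi>" by (rule prv_mono)
    moreover have "T \<turnstile> Neg \<phi>" using T(1) by (auto intro: assm)
    ultimately show False using T(2) by (blast intro: prv_NegE)
  qed
  ultimately show ?thesis unfolding F_def Let_def by blast
qed

end
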